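(* Let $\mathrm{X}\in\{\mathrm{I},\mathrm{III},\mathrm{IV}\}$, with $G_{\mathrm{X}}$, $q_{\mathrm{X}}$, $w_{\mathrm{X}}$ as in the context. Then: (I)(1) For every $\ell$ with $\varphi_\ell^{G_{\mathrm{X}}}\not\equiv 0$, the zeta polynomial $P_{\widetilde{\varphi_{\ell}^{G_{\mathrm{X}}}}}(T)$ (with respect to $q=q_{\mathrm{X}}$) satisfies the Riemann hypothesis analogue, i.e. all its zeros have absolute value $1/\sqrt{q_{\mathrm{X}}}$. (I)(2) For every such $\ell$, the zeros of $P_{\widetilde{\varphi_{\ell}^{G_{\mathrm{X}}}}}(T)$ interlace those of $P_{\widetilde{\varphi_{\ell+w_{\mathrm{X}}}^{G_{\mathrm{X}}}}}(T)$. (I)(3) Let $p$ be an odd prime, and assume $p\neq 3$ in the Type III case. Then the coefficients of $P_{\widetilde{\varphi_{2(p-1)}^{G_{\mathrm{X}}}}}(T)$ (with respect to $q=q_{\mathrm{X}}$) are $p$-integral. (II) Let $p$ be an odd prime, and assume $p\neq 3$ in the Type III case. Then the coefficients of $\widetilde{\varphi_{2(p-1)}^{G_{\mathrm{X}}}}(x,y)$ are $p$-integral. (III) Let $p$ be an odd prime, and assume $p\neq 3$ in the Type III case. Then the Fourier coefficients of $Th(\widetilde{\varphi_{2(p-1)}^{G_{\mathrm{X}}}})$ are $p$-integral. (Here, in (I)(3), (II), (III), the statement concerns those $p$ for which $\varphi_{2(p-1)}^{G_{\mathrm{X}}}\not\equiv 0$, so that the normalization is defined.)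
   Context: Groups (acting on column vectors ${}^t(x,y)$): $G_{\mathrm{I}}=\left\langle \frac{1}{\sqrt2}\begin{pmatrix}1&1\\1&-1\end{pmatrix},\begin{pmatrix}1&0\\0&-1\end{pmatrix}\right\rangle$, $G_{\mathrm{III}}=\left\langle \frac{1}{\sqrt3}\begin{pmatrix}1&2\\1&-1\end{pmatrix},\begin{pmatrix}1&0\\0&e^{2\pi\sqrt{-1}/3}\end{pmatrix}\right\rangle$, $G_{\mathrm{IV}}=\left\langle \frac{1}{2}\begin{pmatrix}1&3\\1&-1\end{pmatrix},\begin{pmatrix}1&0\\0&-1\end{pmatrix}\right\rangle$ (finite groups). For $\sigma=\begin{pmatrix}a&b\\c&d\end{pmatrix}$ put $\sigma x:=ax+by$. The Eisenstein polynomial of degree $\ell$ is $\varphi_\ell^{G_{\mathrm{X}}}(x,y)=\frac{1}{|G_{\mathrm{X}}|}\sum_{\sigma\in G_{\mathrm{X}}}(\sigma x)^\ell$. When $\varphi_\ell^{G_{\mathrm{X}}}\not\equiv0$, $\widetilde{\varphi_\ell^{G_{\mathrm{X}}}}$ denotes $\varphi_\ell^{G_{\mathrm{X}}}$ divided by its coefficient of $x^\ell$. Constants: $q_{\mathrm{I}}=2$, $w_{\mathrm{I}}=2$; $q_{\mathrm{III}}=3$, $w_{\mathrm{III}}=4$; $q_{\mathrm{IV}}=4$, $w_{\mathrm{IV}}=2$. Zeta polynomial: a formal weight enumerator of degree $n$ is a homogeneous $f\in\mathbb{C}[x,y]$ of degree $n$ with $x^n$-coefficient $1$; writing $f=x^n+\sum_{i=d}^nA_ix^{n-i}y^i$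 with $A_d\neq0$, $d$ is its minimum distance. For a real $q\neq1$, there is a unique polynomial $P_f(T)\in\mathbb{C}[T]$ of degree at most $n-d$ such that the coefficient of $T^{n-d}$ in the power series $\frac{P_f(T)}{(1-T)(1-qT)}(xT+y(1-T))^n$ equals $\frac{f(x,y)-x^n}{q-1}$; this is the zeta polynomial of $f$ with respect to $q$. $f$ satisfies the Riemann hypothesis analogue (RHA) if all zeros of $P_f$ have absolute value $1/\sqrt q$. Interlacing refers to the zeros on the circle $|T|=1/\sqrt{q_{\mathrm{X}}}$. A rational number $a$ is $p$-integral if $v_p(a)\ge0$, where $v_p$ is the $p$-adic valuation. Theta map: $Th$ is the ring homomorphism $\mathbb{C}[x,y]\to$ functions on the upper half-plane sending $x\mapsto f_0(\tau)=\sum_{b\in\mathbb{Z},\,b\equiv0\ (2)}\exp(\pi\sqrt{-1}\tau b^2/2)$ and $y\mapsto f_1(\tau)=\sum_{b\in\mathbb{Z},\,b\equiv1\ (2)}\exp(\pi\sqrt{-1}\tau b^2/2)$; coefficients of $Th(f)$ mean the coefficients of its expansion in powers of $\exp(\pi\sqrt{-1}\tau/2)$.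
   Formalization: In (I)(3) the prime p = 3 is excluded for Types I and IV as well, because the claim fails there: for ℓ = 4 the zeta polynomials are (1+2T²)/3 and (1−2T+4T²)/3, which are not 3-integral. *)

theory Defs
  imports
    "HOL-Analysis.Analysis"
    "HOL-Algebra.Generated_Groups"
    "HOL-Computational_Algebra.Computational_Algebra"
begin

section \<open>The groups\<close>

definition GL2 :: "(complex^2^2) monoid" where
  "GL2 = \<lparr>carrier = {A. invertible A}, mult = (**), one = mat 1\<rparr>"

definition mat2 :: "complex \<Rightarrow> complex \<Rightarrow> complex \<Rightarrow> complex \<Rightarrow> complex^2^2" where
  "mat2 a b c d = vector [vector [a, b], vector [c, d]]"

datatype gtype = TypeI | TypeIII | TypeIV

fun grp :: "gtype \<Rightarrow> (complex^2^2) set" where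
  "grp TypeI = generate GL2 {(1 / sqrt 2) *\<^sub>R mat2 1 1 1 (-1), mat2 1 0 0 (-1)}"
| "grp TypeIII = generate GL2 {(1 / sqrt 3) *\<^sub>R mat2 1 2 1 (-1),
                               mat2 1 0 0 (exp (2 * complex_of_real pi * \<i> / 3))}"
| "grp TypeIV = generate GL2 {(1 / 2) *\<^sub>R mat2 1 3 1 (-1), mat2 1 0 0 (-1)}"

fun qpar :: "gtype \<Rightarrow> real" where
  "qpar TypeI = 2"
| "qpar TypeIII = 3"
| "qpar TypeIV = 4"

fun wpar :: "gtype \<Rightarrow> nat" where
  "wpar TypeI = 2"
| "wpar TypeIII = 4"
| "wpar TypeIV = 2"

section \<open>Polynomials in two variables\<close>

text \<open>The ring \<open>\<complex>[x,y]\<close> is represented as \<open>(\<complex>[x])[y]\<close>: the outer variable is \<open>y\<close>, the inner one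
  is \<open>x\<close>. A constant \<open>c\<close> is embedded as \<open>[:[:c:]:]\<close>, and \<open>smult [:c:]\<close> is scalar multiplication.\<close>

type_synonym bpoly = "complex poly poly"

definition varx :: bpoly where "varx = [:[:0, 1:]:]"
definition vary :: bpoly where "vary = [:0, 1:]"

text \<open>\<open>bcoeff f i j\<close> is the coefficient of \<open>x\<^sup>i y\<^sup>j\<close>.\<close>

definition bcoeff :: "bpoly \<Rightarrow> nat \<Rightarrow> nat \<Rightarrow> complex" where
  "bcoeff f i j = coeff (coeff f j) i"

section \<open>Eisenstein polynomials\<close>

definition act_x :: "complex^2^2 \<Rightarrow> bpoly" where
  "act_x \<sigma> = smult [:\<sigma> $ 1 $ 1:] varx + smult [:\<sigma> $ 1 $ 2:] vary"

definition eisenstein :: "gtype \<Rightarrow> nat \<Rightarrow> bpoly" where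
  "eisenstein X l = smult [:1 / of_nat (card (grp X)):] (\<Sum>\<sigma>\<in>grp X. act_x \<sigma> ^ l)"

definition eisenstein_normalized :: "gtype \<Rightarrow> nat \<Rightarrow> bpoly" where
  "eisenstein_normalized X l = smult [:1 / bcoeff (eisenstein X l) l 0:] (eisenstein X l)"

section \<open>Zeta polynomials\<close>

text \<open>Below, \<open>f\<close> is meant to be homogeneous of degree \<open>n\<close> with \<open>x\<^sup>n\<close>-coefficient \<open>1\<close> and
  \<open>f \<noteq> x\<^sup>n\<close>.\<close>

definition min_dist :: "nat \<Rightarrow> bpoly \<Rightarrow> nat" where
  "min_dist n f = (LEAST i. 1 \<le> i \<and> i \<le> n \<and> bcoeff f (n - i) i \<noteq> 0)"

text \<open>\<open>\<complex>[x,y]\<close> is not a field, so the quotient \<open>P(T) / ((1 - T)(1 - qT))\<close> is formed in \<open>\<complex>[[T]]\<close> and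
  then embedded coefficientwise into \<open>\<complex>[x,y][[T]]\<close>.\<close>

definition fps_embed :: "complex fps \<Rightarrow> bpoly fps" where
  "fps_embed F = Abs_fps (\<lambda>k. [:[:fps_nth F k:]:])"

definition zeta_series :: "real \<Rightarrow> nat \<Rightarrow> complex poly \<Rightarrow> bpoly fps" where
  "zeta_series q n P =
     fps_embed (fps_of_poly P / ((1 - fps_X) * (1 - fps_const (complex_of_real q) * fps_X)))
     * (fps_const varx * fps_X + fps_const vary * (1 - fps_X)) ^ n"

definition is_zeta_poly :: "real \<Rightarrow> nat \<Rightarrow> bpoly \<Rightarrow> complex poly \<Rightarrow> bool" where
  "is_zeta_poly q n f P \<longleftrightarrow>
     degree P \<le> n - min_dist n f \<and>
     fps_nth (zeta_series q n P) (n - min_dist n f)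
       = smult [:1 / (complex_of_real q - 1):] (f - varx ^ n)"

definition zeta_poly :: "real \<Rightarrow> nat \<Rightarrow> bpoly \<Rightarrow> complex poly" where
  "zeta_poly q n f = (THE P. is_zeta_poly q n f P)"

definition RHA :: "real \<Rightarrow> complex poly \<Rightarrow> bool" where
  "RHA q P \<longleftrightarrow> (\<forall>z. poly P z = 0 \<longrightarrow> cmod z = 1 / sqrt q)"

definition zero_angles :: "real \<Rightarrow> complex poly \<Rightarrow> real set" where
  "zero_angles r P = {t. poly P (complex_of_real r * cis t) = 0}"

text \<open>The zeros of \<open>P\<close> on the circle \<open>|T| = r\<close> interlace those of \<open>Q\<close>, where \<open>Q\<close> may have more zeros
  than \<open>P\<close>: there is no common zero, and any open arc joining two cyclically consecutive zeros of
  \<open>P\<close> contains a zero of \<open>Q\<close>. Equivalently, every zero of \<open>P\<close> lies in an open arc between two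
  cyclically consecutive zeros of \<open>Q\<close>, and distinct zeros of \<open>P\<close> lie in distinct such arcs
  (Stieltjes interlacing). Arcs are expressed through the angles, which form a
  \<open>2\<pi>\<close>-periodic subset of the real line, so the arc across angle \<open>0\<close> is covered as well.\<close>

definition interlace_on_circle :: "real \<Rightarrow> complex poly \<Rightarrow> complex poly \<Rightarrow> bool" where
  "interlace_on_circle r P Q \<longleftrightarrow>
     zero_angles r P \<inter> zero_angles r Q = {} \<and>
     (\<forall>a \<in> zero_angles r P. \<forall>b \<in> zero_angles r P. a < b \<longrightarrow>
        (\<exists>c \<in> zero_angles r Q. a < c \<and> c < b))"

section \<open>Integrality at a prime\<close>

definition padic_val :: "nat \<Rightarrow> rat \<Rightarrow> int" where
  "padic_val p a = int (multiplicity (int p) (fst (quotient_of a)))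
                 - int (multiplicity (int p) (snd (quotient_of a)))"

text \<open>The case \<open>a = 0\<close> is the convention \<open>v\<^sub>p(0) = \<infinity>\<close>. For a complex number, being \<open>p\<close>-integral
  includes being rational.\<close>

definition p_integral :: "nat \<Rightarrow> complex \<Rightarrow> bool" where
  "p_integral p z \<longleftrightarrow> (\<exists>a::rat. z = of_rat a \<and> (a = 0 \<or> padic_val p a \<ge> 0))"

text \<open>The prime \<open>3\<close> is exceptional for zeta polynomials. The normalized Eisenstein polynomials of degree
  \<open>4 = 2(3 - 1)\<close> of types I and IV are \<open>(x\<^sup>2 + y\<^sup>2)\<^sup>2\<close> and \<open>(x\<^sup>2 + 3y\<^sup>2)\<^sup>2\<close>; their coefficients are
  integers, but their zeta polynomials are \<open>(1 + 2T\<^sup>2)/3\<close> (\<open>q = 2\<close>) and \<open>(1 - 2T + 4T\<^sup>2)/3\<close>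
  (\<open>q = 4\<close>), which are not \<open>3\<close>-integral.\<close>

section \<open>The theta map\<close>

definition theta0 :: "complex \<Rightarrow> complex" where
  "theta0 \<tau> = (\<Sum>\<^sub>\<infinity>b\<in>{b::int. even b}. exp (complex_of_real pi * \<i> * \<tau> * of_int b ^ 2 / 2))"

definition theta1 :: "complex \<Rightarrow> complex" where
  "theta1 \<tau> = (\<Sum>\<^sub>\<infinity>b\<in>{b::int. odd b}. exp (complex_of_real pi * \<i> * \<tau> * of_int b ^ 2 / 2))"

definition Th :: "bpoly \<Rightarrow> complex \<Rightarrow> complex" where
  "Th f \<tau> = poly (poly f [:theta1 \<tau>:]) (theta0 \<tau>)"

text \<open>The coefficients of the (unique) expansion of \<open>F\<close> on the upper half-plane in powers of
  \<open>exp (\<pi> i \<tau> / 2)\<close>.\<close>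

definition fourier_coeff :: "(complex \<Rightarrow> complex) \<Rightarrow> nat \<Rightarrow> complex" where
  "fourier_coeff F = (THE c. \<forall>\<tau>. Im \<tau> > 0 \<longrightarrow>
     (\<lambda>m. c m * exp (complex_of_real pi * \<i> * \<tau> / 2) ^ m) sums F \<tau>)"

end

theory Submission
  imports Defs
begin

text \<open>If the group is infinite, \<open>card\<close> makes the Eisenstein polynomial vanish, so one may assume it
  finite. Then \<open>\<phi>\<^sub>l\<close> is the average of \<open>(a x + b y)\<^sup>l\<close> over the orbit of the row \<open>(1, 0)\<close>, which is
  \<open>(1, 0)\<close>, \<open>(0, 1)\<close>, \<open>(1, \<plusminus>1)/\<surd>2\<close> up to sign in type I, \<open>(1, 0)\<close>, \<open>(1, 2 \<omega>\<^sup>j)/\<surd>3\<close> up to powers of \<open>\<i>\<close> in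
  type III, and \<open>(1, 0)\<close>, \<open>(1, \<plusminus>3)/2\<close> up to sign in type IV; it vanishes unless \<open>w\<close> divides \<open>l\<close>.
  The coefficients of the normalized polynomial are thus explicit, and so are the zeta polynomials:
  with \<open>Z(T) = P(T) / ((1 - T) (1 - q T))\<close>, the defining relation says that \<open>(q - 1) n choose i\<close> times
  the coefficient of \<open>T\<^bsup>i - d\<^esup>\<close> in \<open>Z(T) (1 - T)\<^sup>i\<close> is the \<open>i\<close>-th coefficient \<open>A\<^sub>i\<close>. Since the coefficient of \<open>T\<^sup>m\<close> in
  \<open>(1 - T)\<^sup>m / (1 - (1 + b) T)\<close> is \<open>b\<^sup>m\<close>, this gives, up to scalars, \<open>2 + 2\<^sup>k T\<^bsup>2k - 2\<^esup>\<close> (type I, \<open>l = 2k\<close>),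
  and the truncations of \<open>1 / (1 + 3 T\<^sup>2)\<close> (type III, \<open>l = 4k\<close>) and of \<open>1 / (1 + 2 T)\<close> (type IV, \<open>l = 2k\<close>),
  whose zeros come from roots of unity. For \<open>l = 2 (p - 1)\<close> the denominators are congruent to \<open>3\<close> or
  \<open>4\<close> modulo \<open>p\<close> by Fermat (in degree 4, where \<open>p = 3\<close>, the coefficients of types I and IV are integers), and the
  theta series have integral coefficients.\<close>

section \<open>Averaging over an orbit\<close>

lemma GL2_simps:
  "carrier GL2 = {A. invertible A}" "A \<otimes>\<^bsub>GL2\<^esub> B = A ** B" "\<one>\<^bsub>GL2\<^esub> = mat 1"
  by (simp_all add: GL2_def)

lemma group_GL2: "group GL2"
proof (rule groupI)
  fix A assume "A \<in> carrier GL2"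
  then obtain B where "A ** B = mat 1" "B ** A = mat 1"
    by (auto simp: GL2_simps invertible_def)
  then show "\<exists>B\<in>carrier GL2. B \<otimes>\<^bsub>GL2\<^esub> A = \<one>\<^bsub>GL2\<^esub>"
    by (auto simp: GL2_simps invertible_def)
qed (auto simp: GL2_simps invertible_mult matrix_mul_assoc invertible_def[of "mat 1"])

text \<open>Left translation permutes a subgroup. This gives the reindexing of group sums behind
  both the orbit average and the vanishing of moments.\<close>

lemma bij_betw_left_mult:
  assumes S: "S \<subseteq> carrier GL2" and \<tau>: "\<tau> \<in> generate GL2 S"
  shows "bij_betw (\<lambda>\<sigma>. \<tau> \<otimes>\<^bsub>GL2\<^esub> \<sigma>) (generate GL2 S) (generate GL2 S)"
    (is "bij_betw _ ?G ?G")
proof (rule bij_betw_byWitness[where f' = "\<lambda>\<sigma>. inv\<^bsub>GL2\<^esub> \<tau> \<otimes>\<^bsub>GL2\<^esub> \<sigma>"])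
  interpret GL: group GL2 by (rule group_GL2)
  have c: "\<And>a. a \<in> ?G \<Longrightarrow> a \<in> carrier GL2"
    using GL.generate_incl[OF S] by blast
  show "\<forall>a\<in>?G. inv\<^bsub>GL2\<^esub> \<tau> \<otimes>\<^bsub>GL2\<^esub> (\<tau> \<otimes>\<^bsub>GL2\<^esub> a) = a"
    using c \<tau> by (simp flip: GL.m_assoc)
  show "\<forall>a\<in>?G. \<tau> \<otimes>\<^bsub>GL2\<^esub> (inv\<^bsub>GL2\<^esub> \<tau> \<otimes>\<^bsub>GL2\<^esub> a) = a"
    using c \<tau> by (simp flip: GL.m_assoc)
  show "(\<lambda>\<sigma>. \<tau> \<otimes>\<^bsub>GL2\<^esub> \<sigma>) ` ?G \<subseteq> ?G"
    using \<tau> by (auto intro: generate.eng)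
  show "(\<lambda>\<sigma>. inv\<^bsub>GL2\<^esub> \<tau> \<otimes>\<^bsub>GL2\<^esub> \<sigma>) ` ?G \<subseteq> ?G"
    using GL.generate_m_inv_closed[OF S \<tau>] by (auto intro: generate.eng)
qed

text \<open>Both sides evaluate the sum of \<open>h (r v* \<sigma>)\<close> over all \<open>\<sigma>\<close> and all rows \<open>r\<close>: for fixed \<open>r\<close> the
  sum over the group does not depend on the point \<open>r\<close> of the orbit, and for fixed \<open>\<sigma>\<close> the sum
  over the rows is invariant. The rows need only represent the orbit up to the symmetries of \<open>h\<close>
  that are recorded in \<open>P\<close>.\<close>

lemma orbit_average:
  fixes h :: "complex^2 \<Rightarrow> complex" and rs :: "(complex^2) list"
  assumes S: "S \<subseteq> carrier GL2"
    and inv: "\<And>g h. g \<in> S \<Longrightarrow> P h \<Longrightarrow> (\<Sum>r\<leftarrow>rs. h (r v* g)) = (\<Sum>r\<leftarrow>rs. h r)"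
    and P: "\<And>h \<sigma>. P h \<Longrightarrow> P (\<lambda>v. h (v v* \<sigma>))"
    and reach: "\<And>r. r \<in> set rs \<Longrightarrow> \<exists>\<tau>\<in>generate GL2 S. r = e v* \<tau>"
    and h: "P h"
  shows "of_nat (length rs) * (\<Sum>\<sigma>\<in>generate GL2 S. h (e v* \<sigma>))
          = of_nat (card (generate GL2 S)) * (\<Sum>r\<leftarrow>rs. h r)"
proof -
  let ?G = "generate GL2 S"
  interpret GL: group GL2 by (rule group_GL2)
  have row: "(\<Sum>r\<leftarrow>rs. h (r v* \<sigma>)) = (\<Sum>r\<leftarrow>rs. h r)" if "\<sigma> \<in> ?G" "P h" for \<sigma> h
    using that
  proof (induction arbitrary: h rule: generate.induct)
    case one
    then show ?case by (simp add: GL2_simps)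
  next
    case (incl g)
    then show ?case by (rule inv)
  next
    case (inv g)
    have "g \<otimes>\<^bsub>GL2\<^esub> inv\<^bsub>GL2\<^esub> g = \<one>\<^bsub>GL2\<^esub>"
      using inv S by (intro GL.r_inv) auto
    then have "g ** inv\<^bsub>GL2\<^esub> g = mat 1"
      by (simp add: GL2_simps)
    \<comment> \<open>The hypothesis for \<open>g\<close> is applied to \<open>h\<close> precomposed
      with right multiplication by the inverse of \<open>g\<close>, a function that again satisfies
      \<open>P\<close>.\<close>
    then show ?case
      using assms(2)[OF inv(1) P[OF inv(2), of "inv\<^bsub>GL2\<^esub> g"]]
      by (simp add: vector_matrix_mul_assoc)
  next
    case (eng g1 g2)
    have "(\<Sum>r\<leftarrow>rs. h (r v* (g1 ** g2))) = (\<Sum>r\<leftarrow>rs. h (r v* g1 v* g2))"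
      by (simp add: vector_matrix_mul_assoc)
    also have "\<dots> = (\<Sum>r\<leftarrow>rs. h (r v* g2))"
      by (rule eng.IH(1)[OF P[OF eng.prems]])
    also have "\<dots> = (\<Sum>r\<leftarrow>rs. h r)"
      by (rule eng.IH(2)[OF eng.prems])
    finally show ?case by (simp add: GL2_simps)
  qed
  have col: "(\<Sum>\<sigma>\<in>?G. h (r v* \<sigma>)) = (\<Sum>\<sigma>\<in>?G. h (e v* \<sigma>))" if r: "r \<in> set rs" for r
  proof -
    obtain \<tau> where \<tau>: "\<tau> \<in> ?G" "r = e v* \<tau>"
      using reach[OF r] by blast
    from sum.reindex_bij_betw[OF bij_betw_left_mult[OF S \<tau>(1)], of "\<lambda>\<sigma>. h (e v* \<sigma>)"]
    show ?thesis
      by (simp add: \<tau>(2) vector_matrix_mul_assoc GL2_simps)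
  qed
  have "of_nat (length rs) * (\<Sum>\<sigma>\<in>?G. h (e v* \<sigma>)) = (\<Sum>r\<leftarrow>rs. \<Sum>\<sigma>\<in>?G. h (e v* \<sigma>))"
    by (simp add: sum_list_triv)
  also have "\<dots> = (\<Sum>r\<leftarrow>rs. \<Sum>\<sigma>\<in>?G. h (r v* \<sigma>))"
    by (intro arg_cong[of _ _ sum_list] map_cong) (simp_all add: col)
  also have "\<dots> = (\<Sum>\<sigma>\<in>?G. \<Sum>r\<leftarrow>rs. h (r v* \<sigma>))"
    by (induction rs) (simp_all add: sum.distrib)
  also have "\<dots> = of_nat (card ?G) * (\<Sum>r\<leftarrow>rs. h r)"
    by (simp add: row h)
  finally show ?thesis .
qed

lemma reach_step:
  assumes "\<exists>\<tau>\<in>generate GL2 S. r = e v* \<tau>" "g \<in> S"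
  shows "\<exists>\<tau>\<in>generate GL2 S. r v* g = e v* \<tau>"
proof -
  obtain \<tau> where \<tau>: "\<tau> \<in> generate GL2 S" "r = e v* \<tau>"
    using assms(1) by blast
  have "\<tau> \<otimes>\<^bsub>GL2\<^esub> g \<in> generate GL2 S"
    by (rule generate.eng[OF \<tau>(1) generate.incl[OF assms(2)]])
  then show ?thesis
    by (rule bexI[rotated]) (simp add: \<tau>(2) GL2_simps vector_matrix_mul_assoc)
qed

lemma reach_self: "\<exists>\<tau>\<in>generate GL2 S. e = e v* \<tau>"
  by (rule bexI[OF _ generate.one]) (simp add: GL2_simps)

lemma mat2_nth [simp]:
  "mat2 a b c d $ 1 $ 1 = a" "mat2 a b c d $ 1 $ 2 = b"
  "mat2 a b c d $ 2 $ 1 = c" "mat2 a b c d $ 2 $ 2 = d"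
  by (simp_all add: mat2_def)

lemma scaleR_mat2: "k *\<^sub>R mat2 a b c d = 
    mat2 (complex_of_real k * a) (complex_of_real k * b) (complex_of_real k * c) (complex_of_real k * d)"
  unfolding vec_eq_iff forall_2
  by (simp only: vector_scaleR_component mat2_nth) (simp add: scaleR_conv_of_real)

lemma row_mult_mat2:
  "(vector [u, v] :: complex^2) v* mat2 a b c d = vector [u * a + v * c, u * b + v * d]"
  unfolding vec_eq_iff forall_2 by (simp add: vector_matrix_mult_def sum_2)

lemma smult_vector2: "k *s (vector [a, b] :: complex^2) = vector [k * a, k * b]"
  by (simp add: vec_eq_iff forall_2)

lemma first_row: "(vector [1, 0] :: complex^2) v* \<sigma> = vector [\<sigma> $ 1 $ 1, \<sigma> $ 1 $ 2]"
  for \<sigma> :: "complex^2^2"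
  by (simp add: vec_eq_iff forall_2 vector_matrix_mult_def sum_2)

lemma invertible_mat2:
  assumes "a * d - b * c \<noteq> 0"
  shows "invertible (mat2 a b c d)"
  using assms by (simp add: invertible_det_nz det_2)

text \<open>A monomial of degree \<open>i + j\<close> does not change when a row is scaled by
  \<open>z\<close>, because \<open>z ^ (i + j) = 1\<close>. So \<open>rs\<close> need only list the
  orbit of (1, 0) up to powers of \<open>z\<close>, and each generator need only permute
  \<open>rs\<close> up to such powers.\<close>

lemma homogeneous_average:
  fixes z :: complex and rs :: "(complex^2) list"
  assumes S: "S \<subseteq> carrier GL2" and fin: "finite (generate GL2 S)"
    and inv: "\<And>g h. g \<in> S \<Longrightarrow> (\<And>v. h (z *s v) = h v) \<Longrightarrow>
                (\<Sum>r\<leftarrow>rs. h (r v* g)) = (\<Sum>r\<leftarrow>rs. h r :: complex)"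
    and reach: "\<And>r. r \<in> set rs \<Longrightarrow> \<exists>\<tau>\<in>generate GL2 S. r = vector [1, 0] v* \<tau>"
    and rs: "rs \<noteq> []" and z: "z ^ (i + j) = 1"
  shows "(\<Sum>\<sigma>\<in>generate GL2 S. (\<sigma> $ 1 $ 1) ^ i * (\<sigma> $ 1 $ 2) ^ j) / of_nat (card (generate GL2 S))
          = (\<Sum>r\<leftarrow>rs. (r $ 1) ^ i * (r $ 2) ^ j) / of_nat (length rs)"
proof -
  have "generate GL2 S \<noteq> {}"
    using generate.one[of GL2 S] by blast
  then have "card (generate GL2 S) \<noteq> 0"
    using fin by simp
  moreover have "of_nat (length rs) * (\<Sum>\<sigma>\<in>generate GL2 S. (\<sigma> $ 1 $ 1) ^ i * (\<sigma> $ 1 $ 2) ^ j)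
      = of_nat (card (generate GL2 S)) * (\<Sum>r\<leftarrow>rs. (r $ 1) ^ i * (r $ 2) ^ j)"
    using orbit_average[where P = "\<lambda>h. \<forall>v. h (z *s v) = h v" and e = "vector [1, 0]" and rs = rs
        and h = "\<lambda>v :: complex^2. (v $ 1) ^ i * (v $ 2) ^ j", OF S] inv reach z
    by (simp add: first_row scalar_vector_matrix_assoc power_mult_distrib power_add)
  ultimately show ?thesis
    using rs by (simp add: field_simps)
qed

text \<open>If (z, 0) lies in the orbit of (1, 0), a left translation of the group multiplies the
  sum by \<open>z ^ (i + j)\<close>, so the sum must vanish.\<close>

lemma homogeneous_average_0:
  fixes z :: complex
  assumes S: "S \<subseteq> carrier GL2"
    and reach: "\<exists>\<tau>\<in>generate GL2 S. vector [z, 0] = vector [1, 0] v* \<tau>"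
    and z: "z ^ (i + j) \<noteq> 1"
  shows "(\<Sum>\<sigma>\<in>generate GL2 S. (\<sigma> $ 1 $ 1) ^ i * (\<sigma> $ 1 $ 2) ^ j) = 0"
proof -
  let ?h = "\<lambda>v :: complex^2. (v $ 1) ^ i * (v $ 2) ^ j"
  let ?s = "\<Sum>\<sigma>\<in>generate GL2 S. ?h (vector [1, 0] v* \<sigma>)"
  interpret GL: group GL2 by (rule group_GL2)
  obtain \<tau> where \<tau>: "\<tau> \<in> generate GL2 S" "vector [z, 0] = vector [1, 0] v* \<tau>"
    using reach by blast
  have "?s = (\<Sum>\<sigma>\<in>generate GL2 S. ?h (vector [1, 0] v* \<tau> v* \<sigma>))"
    using sum.reindex_bij_betw[OF bij_betw_left_mult[OF S \<tau>(1)], of "\<lambda>\<sigma>. ?h (vector [1, 0] v* \<sigma>)"]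
    by (simp only: vector_matrix_mul_assoc GL2_simps)
  also have "\<dots> = z ^ (i + j) * ?s"
  proof -
    have "?h (vector [1, 0] v* \<tau> v* \<sigma>) = z ^ (i + j) * ?h (vector [1, 0] v* \<sigma>)" for \<sigma>
      unfolding \<tau>(2)[symmetric]
      by (simp add: vector_matrix_mult_def sum_2 power_add power_mult_distrib)
    then show ?thesis by (simp add: sum_distrib_left)
  qed
  finally have "?s = 0"
    using z by simp
  then show ?thesis by (simp add: first_row)
qed

lemma reach_mat2:
  assumes "\<exists>\<tau>\<in>generate GL2 S. vector [u, v] = e v* \<tau>" "mat2 a b c d \<in> S"
    "u' = u * a + v * c" "v' = u * b + v * d"
  shows "\<exists>\<tau>\<in>generate GL2 S. vector [u', v'] = e v* \<tau>"
  using reach_step[OF assms(1,2)] assms(3,4) by (simp add: row_mult_mat2)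

lemma even_average:
  fixes h :: "complex^2 \<Rightarrow> complex"
  assumes "\<And>v. h ((-1) *s v) = h v"
  shows "h (vector [- a, - b]) = h (vector [a, b])" "h (vector [- a, b]) = h (vector [a, - b])"
    "h (vector [0, - b]) = h (vector [0, b])"
  using assms[of "vector [a, b]"] assms[of "vector [a, - b]"] assms[of "vector [0, b]"]
  by (simp_all add: smult_vector2)

section \<open>Moments of the first row for the three groups\<close>

lemma moment_TypeI:
  assumes fin: "finite (grp TypeI)"
  defines "s \<equiv> complex_of_real (1 / sqrt 2)"
  shows "(\<Sum>\<sigma>\<in>grp TypeI. (\<sigma> $ 1 $ 1) ^ i * (\<sigma> $ 1 $ 2) ^ j) / of_nat (card (grp TypeI))
    = (if even (i + j) then (0 ^ j + 0 ^ i + s ^ (i + j) * (1 + (-1) ^ j)) / 4 else 0)"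
proof -
  define S where "S = {mat2 s s s (- s), mat2 1 0 0 (- 1)}"
  have G: "grp TypeI = generate GL2 S"
    by (simp add: S_def s_def scaleR_mat2)
  have s2: "s * s = 1 / 2"
    by (simp add: s_def flip: of_real_mult)
  have fin': "finite (generate GL2 S)"
    using fin by (simp only: G)
  have S: "S \<subseteq> carrier GL2"
    using s2 by (auto simp: S_def GL2_simps intro!: invertible_mat2)
  \<comment> \<open>Alternating the two generators walks along the orbit. The first four rows
    represent it up to sign; the walk continues to (-1, 0), which forces the moments of odd degree
    to vanish.\<close>
  let ?R = "\<lambda>r. \<exists>\<tau>\<in>generate GL2 S. r = vector [1, 0] v* \<tau>"
  have r1: "?R (vector [1, 0])"
    by (rule reach_self)
  have r2: "?R (vector [s, s])"
    by (rule reach_mat2[OF r1, of s s s "- s"]) (simp_all add: S_def)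
  have r3: "?R (vector [s, - s])"
    by (rule reach_mat2[OF r2, of 1 0 0 "- 1"]) (simp_all add: S_def)
  have r4: "?R (vector [0, 1])"
    by (rule reach_mat2[OF r3, of s s s "- s"]) (simp_all add: S_def s2)
  have r5: "?R (vector [0, - 1])"
    by (rule reach_mat2[OF r4, of 1 0 0 "- 1"]) (simp_all add: S_def)
  have r6: "?R (vector [- s, s])"
    by (rule reach_mat2[OF r5, of s s s "- s"]) (simp_all add: S_def)
  have r7: "?R (vector [- s, - s])"
    by (rule reach_mat2[OF r6, of 1 0 0 "- 1"]) (simp_all add: S_def)
  have r8: "?R (vector [- 1, 0])"
    by (rule reach_mat2[OF r7, of s s s "- s"]) (simp_all add: S_def s2)
  show ?thesis
  proof (cases "even (i + j)")
    case True
    have "(\<Sum>\<sigma>\<in>generate GL2 S. (\<sigma> $ 1 $ 1) ^ i * (\<sigma> $ 1 $ 2) ^ j) / of_nat (card (generate GL2 S))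
      = (\<Sum>r\<leftarrow>[vector [1, 0], vector [0, 1], vector [s, s], vector [s, - s] :: complex^2].
          (r $ 1) ^ i * (r $ 2) ^ j) / of_nat (length [vector [1, 0], vector [0, 1], vector [s, s], vector [s, - s] :: complex^2])"
    proof (rule homogeneous_average[where z = "- 1", OF S])
      fix g and h :: "complex^2 \<Rightarrow> complex"
      assume "g \<in> S" and h: "\<And>v. h ((-1) *s v) = h v"
      \<comment> \<open>The first generator exchanges (1, 0) with (s, s) and (0, 1) with (s, -s).
        The second exchanges (s, s) with (s, -s) and changes the sign of (0, 1).\<close>
      then show "(\<Sum>r\<leftarrow>[vector [1, 0], vector [0, 1], vector [s, s], vector [s, - s]]. h (r v* g))
        = (\<Sum>r\<leftarrow>[vector [1, 0], vector [0, 1], vector [s, s], vector [s, - s]]. h r)"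
        using even_average[of h, OF h] by (auto simp: S_def row_mult_mat2 s2)
    qed (use fin' True r1 r2 r3 r4 in \<open>auto\<close>)
    also have "\<dots> = (0 ^ j + 0 ^ i + s ^ (i + j) * (1 + (-1) ^ j)) / 4"
      by (simp add: power_add algebra_simps power_minus[of s])
    finally show ?thesis
      using True by (simp only: G if_True)
  next
    case False
    then have "(\<Sum>\<sigma>\<in>generate GL2 S. (\<sigma> $ 1 $ 1) ^ i * (\<sigma> $ 1 $ 2) ^ j) = 0"
      by (intro homogeneous_average_0[OF S r8]) simp
    then show ?thesis
      using False by (simp only: G) simp
  qed
qed

lemma moment_TypeIV:
  assumes fin: "finite (grp TypeIV)"
  shows "(\<Sum>\<sigma>\<in>grp TypeIV. (\<sigma> $ 1 $ 1) ^ i * (\<sigma> $ 1 $ 2) ^ j) / of_nat (card (grp TypeIV))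
    = (if even (i + j) then (0 ^ j + (1 / 2) ^ (i + j) * (3 ^ j + (-3) ^ j)) / 3 else 0)"
proof -
  define S where "S = {mat2 (1/2) (3/2) (1/2) (- 1/2), mat2 1 0 0 (- 1)}"
  have G: "grp TypeIV = generate GL2 S"
    by (simp add: S_def scaleR_mat2)
  have fin': "finite (generate GL2 S)"
    using fin by (simp only: G)
  have S: "S \<subseteq> carrier GL2"
    by (auto simp: S_def GL2_simps intro!: invertible_mat2)
  let ?R = "\<lambda>r. \<exists>\<tau>\<in>generate GL2 S. r = vector [1, 0] v* \<tau>"
  have r1: "?R (vector [1, 0])"
    by (rule reach_self)
  have r2: "?R (vector [1/2, 3/2])"
    by (rule reach_mat2[OF r1, of "1/2" "3/2" "1/2" "- 1/2"]) (simp_all add: S_def)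
  have r3: "?R (vector [1/2, - 3/2])"
    by (rule reach_mat2[OF r2, of 1 0 0 "- 1"]) (simp_all add: S_def)
  have r4: "?R (vector [- 1/2, 3/2])"
    by (rule reach_mat2[OF r3, of "1/2" "3/2" "1/2" "- 1/2"]) (simp_all add: S_def)
  have r5: "?R (vector [- 1/2, - 3/2])"
    by (rule reach_mat2[OF r4, of 1 0 0 "- 1"]) (simp_all add: S_def)
  have r6: "?R (vector [- 1, 0])"
    by (rule reach_mat2[OF r5, of "1/2" "3/2" "1/2" "- 1/2"]) (simp_all add: S_def)
  show ?thesis
  proof (cases "even (i + j)")
    case True
    have "(\<Sum>\<sigma>\<in>generate GL2 S. (\<sigma> $ 1 $ 1) ^ i * (\<sigma> $ 1 $ 2) ^ j) / of_nat (card (generate GL2 S))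
      = (\<Sum>r\<leftarrow>[vector [1, 0], vector [1/2, 3/2], vector [1/2, - 3/2] :: complex^2].
          (r $ 1) ^ i * (r $ 2) ^ j) / of_nat (length [vector [1, 0], vector [1/2, 3/2], vector [1/2, - 3/2] :: complex^2])"
    proof (rule homogeneous_average[where z = "- 1", OF S])
      fix g and h :: "complex^2 \<Rightarrow> complex"
      assume "g \<in> S" and h: "\<And>v. h ((-1) *s v) = h v"
      \<comment> \<open>The first generator exchanges the first two rows and negates the third; the
        second fixes the first row and exchanges the other two.\<close>
      then show "(\<Sum>r\<leftarrow>[vector [1, 0], vector [1/2, 3/2], vector [1/2, - 3/2]]. h (r v* g))
        = (\<Sum>r\<leftarrow>[vector [1, 0], vector [1/2, 3/2], vector [1/2, - 3/2]]. h r)"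
        using even_average(1)[of h "1/2" "3/2", OF h] even_average(2)[of h "1/2" "3/2", OF h]
        by (auto simp: S_def row_mult_mat2)
    qed (use fin' True r1 r2 r3 in \<open>auto\<close>)
    also have "\<dots> = (0 ^ j + (1 / 2) ^ (i + j) * (3 ^ j + (-3) ^ j)) / 3"
      using power_divide[of "- 3 :: complex" 2 j] by (simp add: power_add field_simps power_divide)
    finally show ?thesis
      using True by (simp only: G if_True)
  next
    case False
    then have "(\<Sum>\<sigma>\<in>generate GL2 S. (\<sigma> $ 1 $ 1) ^ i * (\<sigma> $ 1 $ 2) ^ j) = 0"
      by (intro homogeneous_average_0[OF S r6]) simp
    then show ?thesis
      using False by (simp only: G) simp
  qed
qed

section \<open>Third roots of unity and the type III moments\<close>

definition cube_root :: complex where "cube_root = exp (2 * complex_of_real pi * \<i> / 3)"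

lemma cube_root_eq: "cube_root = Complex (- 1 / 2) (sqrt 3 / 2)"
proof -
  have "cube_root = cis (2 * pi / 3)"
    by (simp add: cube_root_def cis_conv_exp field_simps)
  then show ?thesis
    by (simp add: complex_eq_iff cos_120 sin_120)
qed

lemma cube_root_square: "cube_root * cube_root = - 1 - cube_root"
  by (simp add: cube_root_eq complex_eq_iff)

lemma cube_root_cubed: "cube_root ^ 3 = 1"
proof -
  have "cube_root ^ 3 = cube_root * (cube_root * cube_root)"
    by (simp add: power3_eq_cube)
  also have "\<dots> = - cube_root - cube_root * cube_root"
    by (subst cube_root_square) (simp add: algebra_simps)
  also have "\<dots> = 1"
    by (simp only: cube_root_square) simp
  finally show ?thesis .
qed

text \<open>The root-of-unity filter for multiples of 3. It puts the condition
  \<open>3 dvd j\<close> into the type III moments, and later into the coefficients computed from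
  the zeta polynomial.\<close>

lemma cube_root_power_sum:
  "1 + cube_root ^ j + (cube_root * cube_root) ^ j = (if 3 dvd j then 3 else 0)"
proof -
  obtain q r where j: "j = 3 * q + r" "r < 3"
    by (metis mult_div_mod_eq mod_less_divisor zero_less_numeral)
  have p: "cube_root ^ j = cube_root ^ r" "(cube_root * cube_root) ^ j = (cube_root * cube_root) ^ r"
    unfolding j(1) power_add power_mult power_mult_distrib by (simp_all add: cube_root_cubed)
  from j(2) consider "r = 0" | "r = 1" | "r = 2" by linarith
  then show ?thesis
  proof cases
    case 3
    have "(cube_root * cube_root) ^ 2 = cube_root ^ 3 * cube_root"
      by (simp add: power2_eq_square power3_eq_cube)
    moreover have "cube_root ^ 2 = - 1 - cube_root"
      by (simp only: power2_eq_square cube_root_square)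
    moreover have "\<not> 3 dvd j"
      using 3 j by presburger
    ultimately show ?thesis
      unfolding p 3 by (simp add: cube_root_cubed)
  next
    case 2
    have "\<not> 3 dvd j"
      using 2 j by presburger
    then show ?thesis
      unfolding p 2 by (simp only: power_one_right cube_root_square) simp
  next
    case 1
    then show ?thesis
      unfolding p by (simp add: j(1))
  qed
qed

lemma moment_TypeIII:
  assumes fin: "finite (grp TypeIII)"
  defines "t \<equiv> complex_of_real (1 / sqrt 3)"
  shows "(\<Sum>\<sigma>\<in>grp TypeIII. (\<sigma> $ 1 $ 1) ^ i * (\<sigma> $ 1 $ 2) ^ j) / of_nat (card (grp TypeIII))
    = (if 4 dvd i + j then (0 ^ j + t ^ (i + j) * 2 ^ j * (if 3 dvd j then 3 else 0)) / 4 else 0)"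
proof -
  define w where "w = cube_root"
  define S where "S = {mat2 t (2 * t) t (- t), mat2 1 0 0 w}"
  have G: "grp TypeIII = generate GL2 S"
    by (simp add: S_def t_def w_def cube_root_def scaleR_mat2 mult.commute)
  have t2: "t * t = 1 / 3"
    by (simp add: t_def flip: of_real_mult)
  have w2: "w * w = - 1 - w"
    by (simp add: w_def cube_root_square)
  have w3: "w * (w * w) = 1"
    using cube_root_cubed by (simp add: w_def power3_eq_cube mult.assoc)
  have "w \<noteq> 0"
    using w3 by auto
  \<comment> \<open>\<open>1 + 2 * w\<close> is \<open>\<i>\<close> times the square root of 3. This
    is where the scalar \<open>\<i>\<close> of the type III group comes from.\<close>
  have it: "\<i> * t = (1 + 2 * w) / 3"
    by (simp add: t_def w_def cube_root_eq complex_eq_iff real_div_sqrt field_simps)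
  have fin': "finite (generate GL2 S)"
    using fin by (simp only: G)
  have S: "S \<subseteq> carrier GL2"
    using t2 \<open>w \<noteq> 0\<close> by (auto simp: S_def GL2_simps mult.assoc intro!: invertible_mat2)
  \<comment> \<open>By \<open>a1\<close> and \<open>a2\<close> the first generator sends the row
    with \<open>w\<close> to \<open>\<i>\<close> times the row with \<open>w * w\<close>, and that
    row to \<open>- \<i>\<close> times the row with \<open>w\<close>. It exchanges (1, 0) and (t,
    2t) exactly, while the second generator fixes (1, 0) and permutes the other three rows
    cyclically.\<close>
  have a1: "t * t + 2 * t * w * t = \<i> * t" "t * (2 * t) + 2 * t * w * (- t) = \<i> * (2 * t * (w * w))"
  proof -
    have "t * t + 2 * t * w * t = (1 + 2 * w) * (t * t)"
      by (simp add: algebra_simps)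
    then show "t * t + 2 * t * w * t = \<i> * t"
      by (simp add: it t2)
    have "\<i> * (2 * t * (w * w)) = (\<i> * t) * 2 * (w * w)"
      by simp
    also have "\<dots> = 2 / 3 * (w * w + 2 * (w * (w * w)))"
      unfolding it by (simp add: algebra_simps)
    also have "\<dots> = 2 / 3 * (1 - w)"
      unfolding w3 by (simp add: w2)
    also have "\<dots> = t * (2 * t) + 2 * t * w * (- t)"
    proof -
      have "t * (2 * t) + 2 * t * w * (- t) = 2 * (t * t) * (1 - w)"
        by (simp add: algebra_simps)
      then show ?thesis by (simp add: t2)
    qed
    finally show "t * (2 * t) + 2 * t * w * (- t) = \<i> * (2 * t * (w * w))" by simp
  qed
  have a2: "t * t + 2 * t * (w * w) * t = - \<i> * t" "t * (2 * t) + 2 * t * (w * w) * (- t) = - \<i> * (2 * t * w)"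
  proof -
    have "t * t + 2 * t * (w * w) * t = (1 + 2 * (w * w)) * (t * t)"
      by (simp add: algebra_simps)
    also have "\<dots> = - ((1 + 2 * w) / 3)"
      unfolding t2 w2 by (simp add: field_simps)
    finally show "t * t + 2 * t * (w * w) * t = - \<i> * t"
      unfolding it[symmetric] by simp
    have "- \<i> * (2 * t * w) = - (\<i> * t) * 2 * w"
      by simp
    also have "\<dots> = - 2 / 3 * (w + 2 * (w * w))"
      unfolding it by (simp add: algebra_simps)
    also have "\<dots> = 2 * (t * t) * (1 - w * w)"
      unfolding w2 t2 by (simp add: field_simps)
    also have "\<dots> = t * (2 * t) + 2 * t * (w * w) * (- t)"
      by (simp add: algebra_simps)
    finally show "t * (2 * t) + 2 * t * (w * w) * (- t) = - \<i> * (2 * t * w)" by simp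
  qed
  let ?R = "\<lambda>r. \<exists>\<tau>\<in>generate GL2 S. r = vector [1, 0] v* \<tau>"
  have AS: "mat2 t (2 * t) t (- t) \<in> S" and DS: "mat2 1 0 0 w \<in> S"
    by (simp_all add: S_def)
  have r1: "?R (vector [1, 0])"
    by (rule reach_self)
  have r2: "?R (vector [t, 2 * t])"
    by (rule reach_mat2[OF r1 AS]) simp_all
  have r3: "?R (vector [t, 2 * t * w])"
    by (rule reach_mat2[OF r2 DS]) simp_all
  have r4: "?R (vector [t, 2 * t * (w * w)])"
    by (rule reach_mat2[OF r3 DS]) simp_all
  \<comment> \<open>The walk goes on to (\<open>\<i>\<close>, 0), which makes all moments vanish in
    degrees not divisible by 4.\<close>
  have r5: "?R (vector [\<i> * t, \<i> * (2 * t * (w * w))])"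
    by (rule reach_mat2[OF r3 AS]) (simp_all only: a1)
  have r6: "?R (vector [\<i> * t, \<i> * (2 * t)])"
    by (rule reach_mat2[OF r5 DS]) (use w3 in \<open>simp_all add: ac_simps\<close>)
  have r7: "?R (vector [\<i>, 0])"
    by (rule reach_mat2[OF r6 AS]) (simp_all add: mult.assoc t2)
  let ?rs = "[vector [1, 0], vector [t, 2 * t], vector [t, 2 * t * w], vector [t, 2 * t * (w * w)]] :: (complex^2) list"
  show ?thesis
  proof (cases "4 dvd i + j")
    case True
    then obtain k where k: "i + j = 4 * k" ..
    have "(\<Sum>\<sigma>\<in>generate GL2 S. (\<sigma> $ 1 $ 1) ^ i * (\<sigma> $ 1 $ 2) ^ j) / of_nat (card (generate GL2 S))
      = (\<Sum>r\<leftarrow>?rs. (r $ 1) ^ i * (r $ 2) ^ j) / of_nat (length ?rs)"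
    proof (rule homogeneous_average[where z = \<i>, OF S])
      fix g and h :: "complex^2 \<Rightarrow> complex"
      assume g: "g \<in> S" and h: "\<And>v. h (\<i> *s v) = h v"
      have h1: "h (vector [\<i> * a, \<i> * b]) = h (vector [a, b])" for a b
        using h[of "vector [a, b]"] by (simp add: smult_vector2)
      have h2: "h (vector [- \<i> * a, - \<i> * b]) = h (vector [a, b])" for a b
        using h1[of "- \<i> * a" "- \<i> * b"] by simp
      from g consider "g = mat2 t (2 * t) t (- t)" | "g = mat2 1 0 0 w"
        by (auto simp: S_def)
      then show "(\<Sum>r\<leftarrow>?rs. h (r v* g)) = (\<Sum>r\<leftarrow>?rs. h r)"
      proof cases
        case 1
        have "t * t + 2 * t * t = 1" "t * (2 * t) + 2 * t * (- t) = 0"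
          by (simp_all add: mult.assoc t2)
        then show ?thesis
          unfolding 1 by (simp only: list.map sum_list.Cons sum_list.Nil row_mult_mat2 a1 a2 h1 h2) simp
      next
        case 2
        have "2 * t * (w * w) * w = 2 * t"
          using w3 by (simp add: ac_simps)
        then show ?thesis
          unfolding 2 by (simp add: row_mult_mat2 mult.assoc w3)
      qed
    qed (use fin' True r1 r2 r3 r4 k in \<open>auto simp: power_mult\<close>)
    also have "(\<Sum>r\<leftarrow>?rs. (r $ 1) ^ i * (r $ 2) ^ j)
      = 0 ^ j + t ^ (i + j) * 2 ^ j * (1 + w ^ j + (w * w) ^ j)"
      by (simp add: power_add algebra_simps power_mult_distrib)
    also have "\<dots> = 0 ^ j + t ^ (i + j) * 2 ^ j * (if 3 dvd j then 3 else 0)"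
      unfolding w_def cube_root_power_sum ..
    finally show ?thesis
      using True by (simp only: G if_True) simp
  next
    case False
    have "\<i> ^ (i + j) \<noteq> 1"
    proof
      assume *: "\<i> ^ (i + j) = 1"
      obtain q r where qr: "i + j = 4 * q + r" "r < 4"
        by (metis mult_div_mod_eq mod_less_divisor zero_less_numeral)
      with False have "r = 1 \<or> r = 2 \<or> r = 3" by presburger
      moreover have "\<i> ^ r = 1"
        using * unfolding qr(1) by (simp add: power_add power_mult)
      ultimately show False
        by (auto simp: power3_eq_cube complex_eq_iff)
    qed
    then have "(\<Sum>\<sigma>\<in>generate GL2 S. (\<sigma> $ 1 $ 1) ^ i * (\<sigma> $ 1 $ 2) ^ j) = 0"
      by (intro homogeneous_average_0[OF S r7])
    then show ?thesis
      using False by (simp only: G) simp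
  qed
qed

section \<open>Homogeneous polynomials and their coefficients\<close>

lemma bcoeff_diff: "bcoeff (f - g) i j = bcoeff f i j - bcoeff g i j"
  by (simp add: bcoeff_def)

lemma bcoeff_smult: "bcoeff (smult [:c:] f) i j = c * bcoeff f i j"
  by (simp add: bcoeff_def)

lemma bcoeff_0 [simp]: "bcoeff 0 i j = 0"
  by (simp add: bcoeff_def)

lemma bcoeff_sum: "bcoeff (\<Sum>x\<in>A. f x) i j = (\<Sum>x\<in>A. bcoeff (f x) i j)"
  by (simp add: bcoeff_def coeff_sum)

lemma bpoly_eqI: "(\<And>i j. bcoeff f i j = bcoeff g i j) \<Longrightarrow> f = g"
  by (simp add: bcoeff_def poly_eq_iff)

lemma var_monomial: "varx ^ a * vary ^ b = monom (monom 1 a) b"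
proof -
  have vars: "varx = monom (monom 1 1) 0" "vary = monom 1 1"
    by (simp_all add: varx_def vary_def monom_Suc monom_0)
  show ?thesis
    unfolding vars by (simp add: monom_power mult_monom del: One_nat_def)
qed

lemma bcoeff_monomial:
  "bcoeff ([:[:c:]:] * (varx ^ a * vary ^ b)) i j = (if i = a \<and> j = b then c else 0)"
  unfolding var_monomial by (simp add: bcoeff_def)

lemma bcoeff_varx_power: "bcoeff (varx ^ n) i j = (if i = n \<and> j = 0 then 1 else 0)"
  using bcoeff_monomial[of 1 n 0 i j] by (simp add: one_pCons[symmetric])

lemma bcoeff_homogeneous_sum:
  "bcoeff (\<Sum>k\<le>n. [:[:c k:]:] * (varx ^ (n - k) * vary ^ k)) i j = (if i + j = n then c j else 0)"
proof -
  have "bcoeff (\<Sum>k\<le>n. [:[:c k:]:] * (varx ^ (n - k) * vary ^ k)) i j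
      = (\<Sum>k\<le>n. if k = j then (if i + j = n then c j else 0) else 0)"
    unfolding bcoeff_sum bcoeff_monomial by (intro sum.cong) auto
  then show ?thesis by auto
qed

lemma bcoeff_linear_power:
  "bcoeff ((smult [:a:] varx + smult [:b:] vary) ^ n) i j
    = (if i + j = n then of_nat (n choose j) * (a ^ i * b ^ j) else 0)"
proof -
  have c: "[:c:] ^ k = [:c ^ k:]" for c :: "'a :: comm_semiring_1" and k
    by (induction k) (simp_all add: one_pCons mult.commute)
  \<comment> \<open>The summands are swapped before expanding, so that the index \<open>k\<close>
    counts powers of \<open>y\<close>.\<close>
  have eq: "(smult [:a:] varx + smult [:b:] vary) ^ n
      = (\<Sum>k\<le>n. [:[:of_nat (n choose k) * (a ^ (n - k) * b ^ k):]:] * (varx ^ (n - k) * vary ^ k))"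
    unfolding add.commute[of "smult [:a:] varx"] binomial_ring
    by (intro sum.cong)
       (simp_all add: smult_power c of_nat_poly mult.commute mult.left_commute)
  show ?thesis
    unfolding eq bcoeff_homogeneous_sum by auto
qed

text \<open>The binomial theorem in each summand reduces everything to averages of monomials in the
  entries of the first row, which are the moments computed above.\<close>

lemma bcoeff_eisenstein:
  "bcoeff (eisenstein X l) i j = (if i + j = l then of_nat (l choose j) *
     ((\<Sum>\<sigma>\<in>grp X. (\<sigma> $ 1 $ 1) ^ i * (\<sigma> $ 1 $ 2) ^ j) / of_nat (card (grp X))) else 0)"
  by (simp add: eisenstein_def act_x_def bcoeff_smult bcoeff_sum bcoeff_linear_power sum_distrib_left sum_divide_distrib)

section \<open>Zeta polynomials\<close>

lemma fps_embed_mult: "fps_embed (F * G) = fps_embed F * fps_embed G"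
proof -
  have c: "(\<Sum>i\<in>A. [:[:g i:]:]) = [:[:\<Sum>i\<in>A. g i:]:]" for A :: "nat set" and g :: "nat \<Rightarrow> complex"
    by (induction A rule: infinite_finite_induct) simp_all
  show ?thesis
    by (rule fps_ext) (simp add: fps_embed_def fps_mult_nth c)
qed

lemma fps_embed_power: "fps_embed (F ^ n) = fps_embed F ^ n"
  by (induction n) (simp_all add: fps_embed_mult, simp add: fps_embed_def fps_eq_iff one_pCons)

lemma fps_embed_X: "fps_embed fps_X = fps_X"
  by (simp add: fps_embed_def fps_eq_iff one_pCons)

lemma fps_embed_1_minus_X: "fps_embed (1 - fps_X) = 1 - fps_X"
  by (simp add: fps_embed_def fps_eq_iff one_pCons)

text \<open>Expanding the n-th power by the binomial theorem, the monomial \<open>x^i y^j\<close>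
  collects \<open>(1 - T)^j\<close> from \<open>y (1 - T)\<close> and \<open>T^i\<close> from
  \<open>x T\<close>.\<close>

lemma zeta_series_nth:
  fixes q :: real and P :: "complex poly"
  defines "Z \<equiv> fps_of_poly P / ((1 - fps_X) * (1 - fps_const (complex_of_real q) * fps_X))"
  shows "bcoeff (fps_nth (zeta_series q n P) m) i j =
    (if i + j = n then of_nat (n choose j) * fps_nth (Z * (1 - fps_X) ^ j * fps_X ^ i) m else 0)"
proof -
  have fc: "fps_const (of_nat k) = (of_nat k :: bpoly fps)" for k
    by (simp add: fps_of_nat)
  have "zeta_series q n P = fps_embed Z * (\<Sum>k\<le>n. of_nat (n choose k) *
      (fps_const vary * (1 - fps_X)) ^ k * (fps_const varx * fps_X) ^ (n - k))"
    unfolding zeta_series_def Z_def[symmetric] add.commute[of "fps_const varx * fps_X"] binomial_ring ..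
  also have "\<dots> = (\<Sum>k\<le>n. fps_const (of_nat (n choose k) * (varx ^ (n - k) * vary ^ k))
      * fps_embed (Z * (1 - fps_X) ^ k * fps_X ^ (n - k)))"
    unfolding sum_distrib_left
    by (intro sum.cong refl)
       (simp only: fps_embed_mult fps_embed_power fps_embed_X fps_embed_1_minus_X power_mult_distrib
          fps_const_mult[symmetric] fps_const_power[symmetric] fc ac_simps)
  finally have eq: "fps_nth (zeta_series q n P) m
      = (\<Sum>k\<le>n. [:[:of_nat (n choose k) * fps_nth (Z * (1 - fps_X) ^ k * fps_X ^ (n - k)) m:]:]
          * (varx ^ (n - k) * vary ^ k))"
    by (simp add: fps_sum_nth fps_embed_def of_nat_poly ac_simps)
  show ?thesis
    unfolding eq bcoeff_homogeneous_sum by auto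
qed

lemma min_dist_eqI:
  assumes "1 \<le> d" "d \<le> n" "bcoeff f (n - d) d \<noteq> 0" "\<And>i. 1 \<le> i \<Longrightarrow> i < d \<Longrightarrow> bcoeff f (n - i) i = 0"
  shows "min_dist n f = d"
  unfolding min_dist_def using assms by (intro Least_equality) (auto simp: not_less[symmetric])

text \<open>In the coefficient of \<open>T^(n - d)\<close>, the factor \<open>T^(n - j)\<close>
  leaves the coefficient of \<open>T^(j - d)\<close> in \<open>Z (1 - T)^j\<close>. With
  \<open>m = j - d\<close> the polynomial identity becomes one scalar equation for each
  \<open>m\<close>.\<close>

lemma is_zeta_poly_iff:
  fixes q :: real and P :: "complex poly"
  defines "Z \<equiv> fps_of_poly P / ((1 - fps_X) * (1 - fps_const (complex_of_real q) * fps_X))"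
  assumes f: "\<And>i j. bcoeff f i j = (if i + j = n then A j else 0)" and A0: "A 0 = 1"
    and d: "min_dist n f = d" "1 \<le> d" "d \<le> n" and Ad: "\<And>i. 1 \<le> i \<Longrightarrow> i < d \<Longrightarrow> A i = 0"
  shows "is_zeta_poly q n f P \<longleftrightarrow> degree P \<le> n - d \<and>
    (\<forall>m\<le>n - d. of_nat (n choose (m + d)) * fps_nth (Z * (1 - fps_X) ^ (m + d)) m
        = A (m + d) / (complex_of_real q - 1))"
proof -
  let ?l = "fps_nth (zeta_series q n P) (n - d)"
  let ?r = "smult [:1 / (complex_of_real q - 1):] (f - varx ^ n)"
  have l: "bcoeff ?l i j = (if i + j = n then of_nat (n choose j) *
      (if n - d < i then 0 else fps_nth (Z * (1 - fps_X) ^ j) (n - d - i)) else 0)" for i j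
    unfolding zeta_series_nth Z_def[symmetric] fps_X_power_mult_right_nth by simp
  have r: "bcoeff ?r i j = (if i + j = n \<and> j \<noteq> 0 then A j / (complex_of_real q - 1) else 0)" for i j
    by (auto simp: bcoeff_smult bcoeff_diff bcoeff_varx_power f A0)
  have "?l = ?r \<longleftrightarrow> (\<forall>m\<le>n - d. of_nat (n choose (m + d)) * fps_nth (Z * (1 - fps_X) ^ (m + d)) m
        = A (m + d) / (complex_of_real q - 1))" (is "_ \<longleftrightarrow> ?C")
  proof
    assume eq: "?l = ?r"
    show ?C
    proof (intro allI impI)
      fix m assume "m \<le> n - d"
      then show "of_nat (n choose (m + d)) * fps_nth (Z * (1 - fps_X) ^ (m + d)) m
        = A (m + d) / (complex_of_real q - 1)"
        using arg_cong[OF eq, of "\<lambda>f. bcoeff f (n - d - m) (m + d)"] d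
        unfolding l r by (simp split: if_splits)
    qed
  next
    assume C: ?C
    show "?l = ?r"
    proof (rule bpoly_eqI)
      fix i j
      show "bcoeff ?l i j = bcoeff ?r i j"
      proof (cases "i + j = n \<and> d \<le> j")
        case True
        then have "j - d \<le> n - d" "n - d - i = j - d" by auto
        with C[rule_format, of "j - d"] True d show ?thesis
          unfolding l r by auto
      next
        \<comment> \<open>For \<open>j < d\<close> the factor \<open>T^(n - j)\<close> exceeds the
          degree \<open>n - d\<close>, so the left side is 0. The right side is 0 by minimality of
          \<open>d\<close>, or for \<open>j = 0\<close> because \<open>x^n\<close> was
          subtracted.\<close>
        case False
        then show ?thesis
          unfolding l r using d Ad[of j] by auto
      qed
    qed
  qed
  then show ?thesis
    by (simp add: is_zeta_poly_def d)
qed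

lemma fps_nth_mult_cong:
  assumes "\<And>k. k \<le> m \<Longrightarrow> fps_nth F k = fps_nth G k"
  shows "fps_nth (F * H) m = fps_nth (G * H) m"
  unfolding fps_mult_nth using assms by (intro sum.cong) auto

text \<open>Uniqueness: the scalar equations form a triangular system for the first
  \<open>n - d + 1\<close> coefficients of \<open>P / ((1 - T) (1 - q T))\<close>, with the nonzero
  binomial coefficients on the diagonal. These determine the coefficients of \<open>P\<close> up to
  its degree bound.\<close>

lemma zeta_poly_eqI:
  assumes f: "\<And>i j. bcoeff f i j = (if i + j = n then A j else 0)" "A 0 = 1"
    and d: "min_dist n f = d" "1 \<le> d" "d \<le> n" and Ad: "\<And>i. 1 \<le> i \<Longrightarrow> i < d \<Longrightarrow> A i = 0"
    and P: "is_zeta_poly q n f P"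
  shows "zeta_poly q n f = P"
  unfolding zeta_poly_def
proof (rule the_equality)
  fix Q assume Q: "is_zeta_poly q n f Q"
  let ?D = "(1 - fps_X) * (1 - fps_const (complex_of_real q) * fps_X)"
  let ?Z = "\<lambda>P. fps_of_poly P / ?D"
  have D0: "fps_nth ?D 0 \<noteq> 0" by simp
  then have mult: "?Z R * ?D = fps_of_poly R" for R
    by (simp add: fps_divide_unit mult.assoc inverse_mult_eq_1)
  have iff: "is_zeta_poly q n f R \<longleftrightarrow> degree R \<le> n - d \<and>
    (\<forall>m\<le>n - d. of_nat (n choose (m + d)) * fps_nth (?Z R * (1 - fps_X) ^ (m + d)) m
        = A (m + d) / (complex_of_real q - 1))" for R
    by (rule is_zeta_poly_iff[OF f d]) (rule Ad)
  have eq: "fps_nth (?Z P) m = fps_nth (?Z Q) m" if "m \<le> n - d" for m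
    using that
  proof (induction m rule: less_induct)
    case (less m)
    have "of_nat (n choose (m + d)) * fps_nth (?Z P * (1 - fps_X) ^ (m + d)) m
        = of_nat (n choose (m + d)) * fps_nth (?Z Q * (1 - fps_X) ^ (m + d)) m"
      using P Q less.prems unfolding iff by simp
    moreover have "(of_nat (n choose (m + d)) :: complex) \<noteq> 0"
      using less.prems d by (simp add: binomial_eq_0_iff)
    ultimately have "fps_nth (?Z P * (1 - fps_X) ^ (m + d)) m = fps_nth (?Z Q * (1 - fps_X) ^ (m + d)) m"
      by (metis mult_left_cancel)
    moreover have "(\<Sum>i<m. fps_nth (?Z P) i * fps_nth ((1 - fps_X) ^ (m + d)) (m - i))
        = (\<Sum>i<m. fps_nth (?Z Q) i * fps_nth ((1 - fps_X) ^ (m + d)) (m - i))"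
      using less by (intro sum.cong) auto
    \<comment> \<open>The earlier terms agree by induction, and the coefficient at index
      \<open>m\<close> itself is multiplied by the constant term of \<open>(1 - T)^(m + d)\<close>,
      which is 1.\<close>
    ultimately show ?case
      by (simp add: fps_mult_nth atLeast0AtMost atMost_Suc lessThan_Suc_atMost[symmetric])
  qed
  have "coeff P m = coeff Q m" if "m \<le> n - d" for m
    using fps_nth_mult_cong[of m "?Z P" "?Z Q" ?D] eq that unfolding mult by simp
  moreover have "coeff P m = coeff Q m" if "m > n - d" for m
    using P Q that unfolding iff by (simp add: coeff_eq_0)
  ultimately show "Q = P"
    by (metis leI poly_eqI)
qed (rule P)

section \<open>Geometric series and the explicit zeta polynomials\<close>

definition geom_fps :: "complex \<Rightarrow> complex fps" where
  "geom_fps b = Abs_fps (\<lambda>k. b ^ k)"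

lemma geom_fps_mult: "(1 - fps_const b * fps_X) * geom_fps b = 1"
proof (rule fps_ext)
  fix n show "fps_nth ((1 - fps_const b * fps_X) * geom_fps b) n = fps_nth 1 n"
    by (cases n) (simp_all add: geom_fps_def algebra_simps)
qed

text \<open>The Cauchy product is the binomial expansion of \<open>(- 1 + (1 + b)) ^ m\<close>. It
  is used with \<open>b\<close> = 1, -1 (type I), \<open>b\<close> = 3, -3 (type IV) and
  \<open>b\<close> = 2 times the third roots of unity (type III).\<close>

lemma geom_fps_binomial: "fps_nth (geom_fps (1 + b) * (1 - fps_X) ^ m) m = b ^ m"
proof -
  have "fps_nth ((1 - fps_X) ^ m :: complex fps) k = of_nat (m choose k) * (-1) ^ k" if "k \<le> m" for k
  proof -
    have "(1 - fps_X :: complex fps) ^ m = (\<Sum>i\<le>m. of_nat (m choose i) * (- fps_X) ^ i * 1 ^ (m - i))"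
      by (metis binomial_ring diff_conv_add_uminus add.commute)
    moreover have "of_nat (m choose i) * (- fps_X) ^ i * 1 ^ (m - i)
        = fps_const (of_nat (m choose i) * (-1) ^ i) * (fps_X :: complex fps) ^ i" for i
    proof -
      have "(- fps_X :: complex fps) ^ i = (fps_const (- 1) * fps_X) ^ i"
        by (simp flip: fps_const_neg)
      then show ?thesis
        by (simp add: power_mult_distrib fps_of_nat[symmetric] mult.assoc flip: fps_const_mult)
    qed
    ultimately have "fps_nth ((1 - fps_X) ^ m :: complex fps) k
      = (\<Sum>i\<le>m. fps_nth (fps_const (of_nat (m choose i) * (-1) ^ i) * fps_X ^ i) k)"
      by (simp only: fps_sum_nth)
    also have "\<dots> = (\<Sum>i\<le>m. if i = k then of_nat (m choose k) * (-1) ^ k else 0)"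
      by (intro sum.cong) auto
    finally show ?thesis using that by simp
  qed
  then have "fps_nth ((1 - fps_X) ^ m * geom_fps (1 + b)) m
      = (\<Sum>k\<le>m. of_nat (m choose k) * (-1) ^ k * (1 + b) ^ (m - k))"
    by (simp add: fps_mult_nth geom_fps_def atLeast0AtMost)
  also have "\<dots> = (- 1 + (1 + b)) ^ m"
    unfolding binomial_ring ..
  finally show ?thesis by (simp add: mult.commute)
qed

text \<open>Only the coefficients of \<open>P\<close> up to index \<open>m\<close> matter, so
  \<open>P\<close> may be replaced by a full series \<open>F\<close> that it truncates. The factor
  \<open>(1 - T)^d\<close> is split off to be absorbed into a partial fraction decomposition
  independent of \<open>m\<close>.\<close>

lemma zeta_value:
  assumes "\<And>j. j \<le> m \<Longrightarrow> coeff P j = fps_nth F j"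
  shows "fps_nth (fps_of_poly P / ((1 - fps_X) * (1 - fps_const q * fps_X)) * (1 - fps_X) ^ (m + d)) m
    = fps_nth (F * (geom_fps 1 * geom_fps q) * (1 - fps_X) ^ d * (1 - fps_X) ^ m) m"
proof -
  let ?D = "(1 - fps_X) * (1 - fps_const q * fps_X)"
  have "?D * (geom_fps 1 * geom_fps q)
      = ((1 - fps_const 1 * fps_X) * geom_fps 1) * ((1 - fps_const q * fps_X) * geom_fps q)"
    by (simp add: ac_simps)
  then have "?D * (geom_fps 1 * geom_fps q) = 1"
    by (simp only: geom_fps_mult mult_1)
  then have "fps_of_poly P / ?D = fps_of_poly P * (geom_fps 1 * geom_fps q)"
    by (simp add: fps_divide_unit fps_inverse_unique)
  then show ?thesis
    using fps_nth_mult_cong[of m "fps_of_poly P" F "geom_fps 1 * geom_fps q * (1 - fps_X) ^ (m + d)"] assms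
    by (simp add: power_add ac_simps)
qed

lemma geom_fps_nth [simp]: "fps_nth (geom_fps b) j = b ^ j"
  by (simp add: geom_fps_def)

text \<open>\<open>A\<^sub>j\<close> for \<open>l = 2k\<close>, \<open>4k\<close>, \<open>2k\<close> in types I, III, IV. The powers of \<open>0\<close> encode the end terms \<open>j = 0\<close> and,
  in type I, \<open>j = 2k\<close>; for \<open>j > 2k\<close> the truncated difference is \<open>0\<close> as well, but the binomial coefficient vanishes.\<close>

definition wenum_I :: "nat \<Rightarrow> nat \<Rightarrow> complex" where
  "wenum_I k j = of_nat ((2 * k) choose j) * (2 ^ k * 0 ^ j + 2 ^ k * 0 ^ (2 * k - j) + 1 + (-1) ^ j) / (2 ^ k + 2)"

definition wenum_III :: "nat \<Rightarrow> nat \<Rightarrow> complex" where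
  "wenum_III k j = of_nat ((4 * k) choose j) * (9 ^ k * 0 ^ j + 2 ^ j * (if 3 dvd j then 3 else 0)) / (9 ^ k + 3)"

definition wenum_IV :: "nat \<Rightarrow> nat \<Rightarrow> complex" where
  "wenum_IV k j = of_nat ((2 * k) choose j) * (4 ^ k * 0 ^ j + 3 ^ j + (-3) ^ j) / (4 ^ k + 2)"

text \<open>For \<open>k = 1\<close> both monomials fall in degree 0 and add up to 1.\<close>

definition zeta_I :: "nat \<Rightarrow> complex poly" where
  "zeta_I k = monom (2 / (2 ^ k + 2)) 0 + monom (2 ^ k / (2 ^ k + 2)) (2 * k - 2)"

text \<open>The bound on the degree is \<open>n - d = 4 * k - 3\<close>, which is odd, so the
  truncated even series ends in degree \<open>4 * k - 4\<close>. The factor 12 is forced by the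
  equation for \<open>m = 0\<close>.\<close>

definition zeta_III :: "nat \<Rightarrow> complex poly" where
  "zeta_III k = (\<Sum>i<2 * k - 1. monom (12 / (9 ^ k + 3) * (-3) ^ i) (2 * i))"

definition zeta_IV :: "nat \<Rightarrow> complex poly" where
  "zeta_IV k = (\<Sum>i<2 * k - 1. monom (6 / (4 ^ k + 2) * (-2) ^ i) i)"

lemma power_add_neq_0: "(of_nat a :: complex) ^ k + of_nat (Suc b) \<noteq> 0"
  by (metis of_nat_add of_nat_power of_nat_eq_0_iff add_is_0 nat.distinct(1))

lemma denom_neq_0 [simp]:
  "(2 :: complex) ^ k + 2 \<noteq> 0" "(4 :: complex) ^ k + 2 \<noteq> 0" "(9 :: complex) ^ k + 3 \<noteq> 0"
  using power_add_neq_0[of 2 k 1] power_add_neq_0[of 4 k 1] power_add_neq_0[of 9 k 2] by simp_all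

lemma zeta_poly_TypeIV:
  assumes f: "\<And>i j. bcoeff f i j = (if i + j = 2 * k then wenum_IV k j else 0)" and k: "k \<ge> 1"
  shows "zeta_poly 4 (2 * k) f = zeta_IV k"
proof -
  let ?c = "6 / (4 ^ k + 2) :: complex"
  have A0: "wenum_IV k 0 = 1"
    by (simp add: wenum_IV_def add.assoc)
  have A1: "wenum_IV k i = 0" if "1 \<le> i" "i < 2" for i
    using that by (simp add: wenum_IV_def less_2_cases_iff)
  have "wenum_IV k 2 \<noteq> 0"
    using k by (simp add: wenum_IV_def binomial_eq_0_iff)
  then have d: "min_dist (2 * k) f = 2"
    using k A1 by (intro min_dist_eqI) (auto simp: f)
  \<comment> \<open>Partial fractions: \<open>(1 - T) / ((1 - 4T) (1 + 2T))\<close> is half the sum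
    of \<open>1 / (1 - 4T)\<close> and \<open>1 / (1 + 2T)\<close>. The poles are written as
    \<open>1 + 3\<close> and \<open>1 + (-3)\<close> to fit
    \<open>geom_fps_binomial\<close>.\<close>
  have geom: "geom_fps (-2) * (geom_fps 1 * geom_fps 4) * (1 - fps_X) ^ 2
      = fps_const (1/2) * (geom_fps (1 + 3) + geom_fps (1 + (-3)))"
  proof -
    define a b e where "a = geom_fps 4" "b = geom_fps (-2)" "e = geom_fps 1"
    have a: "(1 - 4 * fps_X) * a = 1" and b: "(1 + 2 * fps_X) * b = 1" and e: "(1 - fps_X) * e = 1"
      using geom_fps_mult[of 4] geom_fps_mult[of "- 2"] geom_fps_mult[of 1]
      by (simp_all add: a_b_e_def numeral_fps_const flip: fps_const_neg)
    have "a + b = a * b * (2 * (1 - fps_X))"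
      using a b by algebra
    moreover have "b * (e * a) * (1 - fps_X) ^ 2 = a * b * (1 - fps_X)"
      using e by algebra
    moreover have "fps_const (1/2) * (2 :: complex fps) = 1"
      by (simp add: numeral_fps_const)
    ultimately have "b * (e * a) * (1 - fps_X) ^ 2 = fps_const (1/2) * (a + b)"
      by algebra
    then show ?thesis
      by (simp add: a_b_e_def)
  qed
  have val: "fps_nth (fps_of_poly (zeta_IV k) / ((1 - fps_X) * (1 - fps_const (complex_of_real 4) * fps_X))
      * (1 - fps_X) ^ (m + 2)) m = ?c / 2 * (3 ^ m + (-3) ^ m)" if m: "m \<le> 2 * k - 2" for m
  proof -
    have "coeff (zeta_IV k) j = fps_nth (fps_const ?c * geom_fps (-2)) j" if "j \<le> m" for j
      using that m k by (auto simp: zeta_IV_def coeff_sum)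
    from zeta_value[OF this, of m "complex_of_real 4" 2]
    have "fps_nth (fps_of_poly (zeta_IV k) / ((1 - fps_X) * (1 - fps_const (complex_of_real 4) * fps_X))
      * (1 - fps_X) ^ (m + 2)) m
      = fps_nth (fps_const ?c * (geom_fps (-2) * (geom_fps 1 * geom_fps 4) * (1 - fps_X) ^ 2) * (1 - fps_X) ^ m) m"
      by (simp add: mult.assoc)
    also have "\<dots> = ?c * (1/2) * (fps_nth (geom_fps (1 + 3) * (1 - fps_X) ^ m) m + fps_nth (geom_fps (1 + (-3)) * (1 - fps_X) ^ m) m)"
      unfolding geom by (simp only: distrib_left distrib_right fps_add_nth mult.assoc fps_mult_left_const_nth)
    finally show ?thesis
      unfolding geom_fps_binomial by simp
  qed
  have "degree (zeta_IV k) \<le> 2 * k - 2"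
    unfolding zeta_IV_def
    by (rule degree_sum_le) (auto intro: order.trans[OF degree_monom_le])
  \<comment> \<open>The shift from \<open>m\<close> to \<open>m + 2\<close> costs a factor 9, and
    the divisor 3 is \<open>q - 1\<close>.\<close>
  moreover have "of_nat ((2 * k) choose (m + 2)) * (?c / 2 * (3 ^ m + (-3) ^ m)) = wenum_IV k (m + 2) / 3" for m
  proof -
    have "N * (6 / D / 2 * (x + y)) = N * (9 * x + 9 * y) / D / 3" for N D x y :: complex
      by (cases "D = 0") (simp_all add: field_simps)
    moreover have "wenum_IV k (m + 2)
        = of_nat ((2 * k) choose (m + 2)) * (9 * 3 ^ m + 9 * (-3) ^ m) / (4 ^ k + 2)"
      by (simp add: wenum_IV_def power_add)
    ultimately show ?thesis
      by (simp only:)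
  qed
  ultimately have "is_zeta_poly 4 (2 * k) f (zeta_IV k)"
    using k val by (subst is_zeta_poly_iff[OF f A0 d _ _ A1]) auto
  then show ?thesis
    using k A1 by (intro zeta_poly_eqI[OF f A0 d]) auto
qed

lemma zeta_poly_TypeI:
  assumes f: "\<And>i j. bcoeff f i j = (if i + j = 2 * k then wenum_I k j else 0)" and k: "k \<ge> 1"
  shows "zeta_poly 2 (2 * k) f = zeta_I k"
proof -
  let ?c = "2 / (2 ^ k + 2) :: complex" and ?c' = "2 ^ k / (2 ^ k + 2) :: complex"
  have A0: "wenum_I k 0 = 1"
    using k by (simp add: wenum_I_def add.assoc)
  have A1: "wenum_I k i = 0" if "1 \<le> i" "i < 2" for i
    using that k by (simp add: wenum_I_def less_2_cases_iff)
  \<comment> \<open>For \<open>k = 1\<close> the index 2 is the last one, so the end term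
    \<open>0 ^ (2 * k - j)\<close> contributes there.\<close>
  have "wenum_I k 2 \<noteq> 0"
  proof (cases "k = 1")
    case False
    then have z: "(0 :: complex) ^ (2 * k - 2) = 0"
      using k by (simp add: power_0_left)
    show ?thesis
      using k by (simp add: z wenum_I_def binomial_eq_0_iff)
  qed (simp add: wenum_I_def)
  then have d: "min_dist (2 * k) f = 2"
    using k A1 by (intro min_dist_eqI) (auto simp: f)
  \<comment> \<open>Here \<open>(1 - T) / (1 - 2T)\<close> is half the sum of
    \<open>1 / (1 - 2T)\<close> and 1; the constant 1 is read as \<open>geom_fps 0\<close>, that is
    \<open>b = -1\<close>.\<close>
  have geom: "(geom_fps 1 * geom_fps 2) * (1 - fps_X) ^ 2
      = fps_const (1/2) * (geom_fps (1 + 1) + geom_fps (1 + (-1)))"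
  proof -
    define a e where "a = geom_fps 2" "e = geom_fps 1"
    have a: "(1 - 2 * fps_X) * a = 1" and e: "(1 - fps_X) * e = 1"
      using geom_fps_mult[of 2] geom_fps_mult[of 1]
      by (simp_all add: a_e_def numeral_fps_const)
    have 0: "geom_fps 0 = 1"
      using geom_fps_mult[of 0] by simp
    have "a + 1 = a * (2 * (1 - fps_X))"
      using a by algebra
    moreover have "(e * a) * (1 - fps_X) ^ 2 = a * (1 - fps_X)"
      using e by algebra
    moreover have "fps_const (1/2) * (2 :: complex fps) = 1"
      by (simp add: numeral_fps_const)
    ultimately have "(e * a) * (1 - fps_X) ^ 2 = fps_const (1/2) * (a + 1)"
      by algebra
    then show ?thesis
      by (simp add: a_e_def 0)
  qed
  have val: "fps_nth (fps_of_poly (zeta_I k) / ((1 - fps_X) * (1 - fps_const (complex_of_real 2) * fps_X))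
      * (1 - fps_X) ^ (m + 2)) m = ?c / 2 * (1 + (-1) ^ m) + (if m = 2 * k - 2 then ?c' else 0)"
    if m: "m \<le> 2 * k - 2" for m
  proof -
    \<comment> \<open>\<open>H\<close> is the factor multiplying the zeta polynomial. In the range
      of \<open>m\<close> the top monomial contributes only at \<open>m = 2 * k - 2\<close>, through
      the constant term of \<open>H\<close>; this produces the \<open>y^(2k)\<close> end
      term.\<close>
    define H where "H = geom_fps 1 * geom_fps 2 * (1 - fps_X) ^ 2 * (1 - fps_X) ^ m"
    have H0: "fps_nth H 0 = 1"
      by (simp add: H_def fps_power_zeroth)
    have Hm: "fps_nth H m = 1/2 * (1 + (-1) ^ m)"
    proof -
      have "fps_nth H m = (1/2) * (fps_nth (geom_fps (1 + 1) * (1 - fps_X) ^ m) m + fps_nth (geom_fps (1 + (-1)) * (1 - fps_X) ^ m) m)"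
        unfolding H_def geom by (simp only: distrib_left distrib_right fps_add_nth mult.assoc fps_mult_left_const_nth)
      then show ?thesis
        unfolding geom_fps_binomial by simp
    qed
    have "coeff (zeta_I k) j = fps_nth (fps_const ?c + fps_const ?c' * fps_X ^ (2 * k - 2)) j" if "j \<le> m" for j
      by (auto simp: zeta_I_def)
    from zeta_value[OF this, of m "complex_of_real 2" 2]
    have "fps_nth (fps_of_poly (zeta_I k) / ((1 - fps_X) * (1 - fps_const (complex_of_real 2) * fps_X))
      * (1 - fps_X) ^ (m + 2)) m
      = fps_nth ((fps_const ?c + fps_const ?c' * fps_X ^ (2 * k - 2)) * H) m"
      by (simp add: mult.assoc H_def)
    also have "\<dots> = ?c * fps_nth H m + ?c' * fps_nth (fps_X ^ (2 * k - 2) * H) m"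
      by (simp add: distrib_right mult.assoc)
    also have "fps_nth (fps_X ^ (2 * k - 2) * H) m = (if m = 2 * k - 2 then 1 else 0)"
      using m H0 by (auto simp: fps_X_power_mult_nth)
    finally show ?thesis
      unfolding Hm by auto
  qed
  have "degree (zeta_I k) \<le> 2 * k - 2"
    unfolding zeta_I_def
    by (intro degree_add_le order.trans[OF degree_monom_le]) auto
  moreover have "of_nat ((2 * k) choose (m + 2)) * (?c / 2 * (1 + (-1) ^ m) + (if m = 2 * k - 2 then ?c' else 0))
      = wenum_I k (m + 2)" if m: "m \<le> 2 * k - 2" for m
  proof (cases "m = 2 * k - 2")
    case True
    then have "m + 2 = 2 * k" "even m"
      using k by auto
    have "2 / D / 2 * (1 + 1) + E / D = (E + 2) / D" for D E :: complex
      by (simp add: add_divide_distrib)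
    from this[of "2 ^ k + 2" "2 ^ k"] have "?c / 2 * (1 + 1) + ?c' = 1"
      by (simp only: divide_self denom_neq_0 not_False_eq_True)
    moreover have "wenum_I k (2 * k) = 1"
      using k by (simp add: wenum_I_def add.assoc power_0_left)
    ultimately show ?thesis
      using \<open>even m\<close> True unfolding \<open>m + 2 = 2 * k\<close>
      by (simp only: power_minus_even power_one simp_thms if_True binomial_n_n of_nat_1 mult_1)
  next
    case False
    then have "(0 :: complex) ^ (2 * k - (m + 2)) = 0"
      using m k by (simp add: power_0_left)
    then have "wenum_I k (m + 2) = of_nat ((2 * k) choose (m + 2)) * (1 + (-1) ^ m) / (2 ^ k + 2)"
      unfolding wenum_I_def by (simp only: power_add) simp
    moreover have "N * (2 / D / 2 * x) = N * x / D" for N D x :: complex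
      by simp
    ultimately show ?thesis
      using False by (simp only: if_False add_0_right)
  qed
  ultimately have "is_zeta_poly 2 (2 * k) f (zeta_I k)"
    using k val by (subst is_zeta_poly_iff[OF f A0 d _ _ A1]) auto
  then show ?thesis
    using k A1 by (intro zeta_poly_eqI[OF f A0 d]) auto
qed

lemma zeta_poly_TypeIII:
  assumes f: "\<And>i j. bcoeff f i j = (if i + j = 4 * k then wenum_III k j else 0)" and k: "k \<ge> 1"
  shows "zeta_poly 3 (4 * k) f = zeta_III k"
proof -
  let ?c = "12 / (9 ^ k + 3) :: complex"
  have A0: "wenum_III k 0 = 1"
    by (simp add: wenum_III_def)
  have A1: "wenum_III k i = 0" if "1 \<le> i" "i < 3" for i
    using that by (auto simp: wenum_III_def dest: dvd_imp_le)
  have "wenum_III k 3 \<noteq> 0"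
    using k by (simp add: wenum_III_def binomial_eq_0_iff)
  then have d: "min_dist (4 * k) f = 3"
    using k A1 by (intro min_dist_eqI) (auto simp: f)
  define w where "w = cube_root"
  \<comment> \<open>\<open>r\<close> is a square root of -3, so \<open>1 / (1 + 3T^2)\<close> splits
    into the geometric series of \<open>r\<close> and \<open>- r\<close>, and these are
    \<open>1 + 2b\<close> for the two primitive third roots of unity \<open>b\<close>.\<close>
  define r where "r = 1 + 2 * w"
  have w2: "w * w = - 1 - w"
    by (simp add: w_def cube_root_square)
  have r': "1 + 2 * (w * w) = - r"
    by (simp add: r_def w2)
  have r2: "r * r = - 3"
    using w2 unfolding r_def by algebra
  \<comment> \<open>Partial fractions of \<open>(1 - T)^2 / ((1 - 3T) (1 + 3T^2))\<close>: all three
    residues are 1/3, since \<open>(1 + 3T^2) + 2 (1 - 3T) = 3 (1 - T)^2\<close>.\<close>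
  have geom: "(geom_fps r * geom_fps (- r)) * (geom_fps 1 * geom_fps 3) * (1 - fps_X) ^ 3
      = fps_const (1/3) * (geom_fps (1 + 2) + geom_fps (1 + 2 * w) + geom_fps (1 + 2 * (w * w)))"
  proof -
    define a b b' e R where "a = geom_fps 3" "b = geom_fps r" "b' = geom_fps (- r)" "e = geom_fps 1" "R = fps_const r"
    have a: "(1 - 3 * fps_X) * a = 1" and b: "(1 - R * fps_X) * b = 1"
      and b': "(1 + R * fps_X) * b' = 1" and e: "(1 - fps_X) * e = 1"
      using geom_fps_mult[of 3] geom_fps_mult[of r] geom_fps_mult[of "- r"] geom_fps_mult[of 1]
      by (simp_all add: a_b_b'_e_R_def numeral_fps_const flip: fps_const_neg)
    have R: "R * R = - 3"
      by (simp add: a_b_b'_e_R_def r2 numeral_fps_const)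
    have "a + b + b' = a * b * b' * (3 * (1 - fps_X) ^ 2)"
    proof -
      have "a = a * b * b' * ((1 - R * fps_X) * (1 + R * fps_X))"
        using b b' by algebra
      moreover have "b = a * b * b' * ((1 - 3 * fps_X) * (1 + R * fps_X))"
        using a b' by algebra
      moreover have "b' = a * b * b' * ((1 - 3 * fps_X) * (1 - R * fps_X))"
        using a b by algebra
      ultimately have "a + b + b' = a * b * b' * ((1 - R * fps_X) * (1 + R * fps_X)
          + (1 - 3 * fps_X) * (1 + R * fps_X) + (1 - 3 * fps_X) * (1 - R * fps_X))"
        by (simp only: distrib_left)
      also have "(1 - R * fps_X) * (1 + R * fps_X)
          + (1 - 3 * fps_X) * (1 + R * fps_X) + (1 - 3 * fps_X) * (1 - R * fps_X) = 3 * (1 - fps_X) ^ 2"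
        using R by algebra
      finally show ?thesis .
    qed
    moreover have "(b * b') * (e * a) * (1 - fps_X) ^ 3 = a * b * b' * (1 - fps_X) ^ 2"
      using e by algebra
    moreover have "fps_const (1/3) * (3 :: complex fps) = 1"
      by (simp add: numeral_fps_const)
    ultimately have "(b * b') * (e * a) * (1 - fps_X) ^ 3 = fps_const (1/3) * (a + b + b')"
      by algebra
    then show ?thesis
      unfolding r' r_def[symmetric] by (simp add: a_b_b'_e_R_def)
  qed
  have E: "fps_nth (geom_fps r * geom_fps (- r)) j = (if even j then (-3) ^ (j div 2) else 0)" for j
  proof -
    define F where "F = Abs_fps (\<lambda>j. if even j then (-3 :: complex) ^ (j div 2) else 0)"
    have F: "(1 + 3 * fps_X ^ 2) * F = 1"
    proof (rule fps_ext)
      fix n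
      have "fps_nth ((1 + 3 * fps_X ^ 2) * F) n = fps_nth F n + 3 * fps_nth (fps_X ^ 2 * F) n"
        by (simp add: distrib_right mult.assoc numeral_fps_const)
      also have "\<dots> = fps_nth 1 n"
      proof -
        consider "n = 0" | "n = 1" | m where "n = Suc (Suc m)"
          by (metis One_nat_def not0_implies_Suc)
        then show ?thesis
          by cases (simp_all add: F_def fps_X_power_mult_nth)
      qed
      finally show "fps_nth ((1 + 3 * fps_X ^ 2) * F) n = fps_nth 1 n" .
    qed
    have R: "fps_const r * fps_const r = - 3"
      by (simp add: r2 numeral_fps_const)
    have b: "(1 - fps_const r * fps_X) * geom_fps r = 1" and b': "(1 + fps_const r * fps_X) * geom_fps (- r) = 1"
      using geom_fps_mult[of r] geom_fps_mult[of "- r"] by (simp_all flip: fps_const_neg)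
    have "geom_fps r * geom_fps (- r) = F"
      using F R b b' by algebra
    then show ?thesis by (simp add: F_def)
  qed
  have val: "fps_nth (fps_of_poly (zeta_III k) / ((1 - fps_X) * (1 - fps_const (complex_of_real 3) * fps_X))
      * (1 - fps_X) ^ (m + 3)) m = ?c / 3 * 2 ^ m * (if 3 dvd m then 3 else 0)" if m: "m \<le> 4 * k - 3" for m
  proof -
    have "coeff (zeta_III k) j = fps_nth (fps_const ?c * (geom_fps r * geom_fps (- r))) j" if j: "j \<le> m" for j
    proof -
      have "coeff (zeta_III k) j = (\<Sum>i<2 * k - 1. if i = j div 2 then (if even j then ?c * (-3) ^ (j div 2) else 0) else 0)"
        unfolding zeta_III_def coeff_sum by (intro sum.cong) auto
      then show ?thesis
        using j m k by (auto simp: E)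
    qed
    from zeta_value[OF this, of m "complex_of_real 3" 3]
    have "fps_nth (fps_of_poly (zeta_III k) / ((1 - fps_X) * (1 - fps_const (complex_of_real 3) * fps_X))
      * (1 - fps_X) ^ (m + 3)) m
      = fps_nth (fps_const ?c * ((geom_fps r * geom_fps (- r)) * (geom_fps 1 * geom_fps 3) * (1 - fps_X) ^ 3) * (1 - fps_X) ^ m) m"
      by (simp add: mult.assoc)
    also have "\<dots> = ?c * (1/3) * (fps_nth (geom_fps (1 + 2) * (1 - fps_X) ^ m) m
        + fps_nth (geom_fps (1 + 2 * w) * (1 - fps_X) ^ m) m + fps_nth (geom_fps (1 + 2 * (w * w)) * (1 - fps_X) ^ m) m)"
      unfolding geom by (simp only: distrib_left distrib_right fps_add_nth mult.assoc fps_mult_left_const_nth)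
    also have "\<dots> = ?c / 3 * 2 ^ m * (1 + w ^ m + (w * w) ^ m)"
    proof -
      have "C * (1/3) * (x + x * y + x * z) = C / 3 * x * (1 + y + z)" for C x y z :: complex
        by (simp add: field_simps)
      then show ?thesis
        unfolding geom_fps_binomial power_mult_distrib by blast
    qed
    finally show ?thesis
      unfolding w_def cube_root_power_sum .
  qed
  have "degree (zeta_III k) \<le> 4 * k - 3"
    unfolding zeta_III_def
    by (rule degree_sum_le) (auto intro: order.trans[OF degree_monom_le])
  \<comment> \<open>The shift from \<open>m\<close> to \<open>m + 3\<close> costs a factor 8 and
    preserves divisibility by 3; the divisor 2 is \<open>q - 1\<close>.\<close>
  moreover have "of_nat ((4 * k) choose (m + 3)) * (?c / 3 * 2 ^ m * (if 3 dvd m then 3 else 0)) = wenum_III k (m + 3) / 2" for m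
  proof -
    have "N * (12 / D / 3 * x * y) = N * (8 * x * y) / D / 2" for N D x y :: complex
      by (cases "D = 0") (simp_all add: field_simps)
    moreover have "wenum_III k (m + 3)
        = of_nat ((4 * k) choose (m + 3)) * (8 * 2 ^ m * (if 3 dvd m then 3 else 0)) / (9 ^ k + 3)"
      by (simp add: wenum_III_def power_add)
    ultimately show ?thesis
      by (simp only:)
  qed
  ultimately have "is_zeta_poly 3 (4 * k) f (zeta_III k)"
    using k val by (subst is_zeta_poly_iff[OF f A0 d _ _ A1]) auto
  then show ?thesis
    using k A1 by (intro zeta_poly_eqI[OF f A0 d]) auto
qed

section \<open>Zeros of the zeta polynomials\<close>

text \<open>Supplies the first zero after \<open>a\<close> when the zeros are equally spaced with
  step \<open>h\<close>.\<close>

lemma next_multiple: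
  fixes a h o' :: real
  assumes "h > 0"
  obtains j :: int where "a < o' + of_int j * h" "o' + of_int j * h \<le> a + h"
proof
  let ?j = "\<lfloor>(a - o') / h\<rfloor> + 1"
  have "(a - o') / h < of_int ?j" "of_int ?j \<le> (a - o') / h + 1"
    by linarith+
  then have "a - o' < of_int ?j * h" "of_int ?j * h \<le> (a - o') + h"
    using assms by (simp_all add: field_simps)
  then show "a < o' + of_int ?j * h" "o' + of_int ?j * h \<le> a + h"
    by linarith+
qed

lemma cis_eq_1_iff: "cis t = 1 \<longleftrightarrow> (\<exists>k::int. t = 2 * pi * of_int k)"
proof -
  have "cis t = 1 \<longleftrightarrow> exp (\<i> * of_real t) = 1"
    by (simp add: cis_conv_exp)
  also have "\<dots> \<longleftrightarrow> (\<exists>k::int. t = 2 * pi * of_int k)"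
    by (auto simp: exp_eq_1 mult_ac)
  finally show ?thesis .
qed

lemma cis_eq_minus_1_iff: "cis t = - 1 \<longleftrightarrow> (\<exists>k::int. t = pi + 2 * pi * of_int k)"
proof -
  have "cis t = - 1 \<longleftrightarrow> cis (t - pi) = 1"
    using minus_equation_iff[of "cis t" 1] by (auto simp: cis_divide[symmetric])
  also have "\<dots> \<longleftrightarrow> (\<exists>k::int. t = pi + 2 * pi * of_int k)"
    unfolding cis_eq_1_iff by (auto simp: algebra_simps)
  finally show ?thesis .
qed

lemma less_multiples_gap:
  fixes a b h :: real and k l :: int
  assumes "h > 0" "a = o' + of_int k * h" "b = o' + of_int l * h" "a < b"
  shows "a + h \<le> b"
proof -
  have "k < l"
    using assms by simp
  then have "real_of_int (k + 1) \<le> of_int l"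
    by linarith
  then have "of_int (k + 1) * h \<le> of_int l * h"
    using \<open>h > 0\<close> by (intro mult_right_mono) auto
  then show ?thesis
    using assms by (simp add: algebra_simps)
qed

text \<open>Zeros of the larger polynomial are spaced more densely: the first zero after \<open>a\<close> comes at distance
  at most \<open>2\<pi> / (N + 2)\<close>, hence before the next zero of the smaller one.\<close>

lemma roots_of_minus_1_interlace:
  fixes N :: nat
  assumes "even N"
  shows "{t. cis (of_nat N * t) = -1} \<inter> {t. cis (of_nat (N + 2) * t) = -1} = {}"
    and "cis (of_nat N * a) = -1 \<Longrightarrow> cis (of_nat N * b) = -1 \<Longrightarrow> a < b \<Longrightarrow>
           \<exists>c. cis (of_nat (N + 2) * c) = -1 \<and> a < c \<and> c < b"
proof -
  show "{t. cis (of_nat N * t) = -1} \<inter> {t. cis (of_nat (N + 2) * t) = -1} = {}"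
  proof (rule ccontr)
    assume "\<not> ?thesis"
    then obtain t where t: "cis (of_nat N * t) = -1" "cis (of_nat (N + 2) * t) = -1"
      by blast
    \<comment> \<open>Dividing the two relations gives \<open>cis t ^ 2 = 1\<close>; as
      \<open>N\<close> is even, \<open>cis (N t)\<close> would then be 1 instead of -1.\<close>
    have "cis (of_nat (N + 2) * t) = cis (of_nat N * t) * cis t ^ 2"
      unfolding power2_eq_square cis_mult by (simp add: distrib_right add.commute)
    then have "cis t ^ 2 = 1"
      using t by simp
    obtain n where n: "N = 2 * n"
      using assms ..
    have "cis (of_nat N * t) = (cis t ^ 2) ^ n"
      using Complex.DeMoivre[of t N] by (simp only: n power_mult)
    then show False
      using t(1) \<open>cis t ^ 2 = 1\<close> by simp
  qed
next
  assume a: "cis (of_nat N * a) = -1" and b: "cis (of_nat N * b) = -1" and ab: "a < b"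
  have N: "N > 0"
    using a by (cases "N = 0") (auto simp: complex_eq_iff)
  let ?h = "2 * pi / of_nat N" and ?h' = "2 * pi / of_nat (N + 2)"
  obtain k l :: int where kl: "of_nat N * a = pi + 2 * pi * of_int k" "of_nat N * b = pi + 2 * pi * of_int l"
    using a b unfolding cis_eq_minus_1_iff by blast
  have "a + ?h \<le> b"
    using kl N by (intro less_multiples_gap[OF _ _ _ ab, where k = k and l = l and o' = "pi / of_nat N"])
      (auto simp: field_simps)
  obtain j :: int where j: "a < pi / of_nat (N + 2) + of_int j * ?h'" "pi / of_nat (N + 2) + of_int j * ?h' \<le> a + ?h'"
    using next_multiple[of ?h' a "pi / of_nat (N + 2)"] by auto
  have "?h' < ?h"
    using N by (intro divide_strict_left_mono) auto
  have "of_nat (N + 2) * (pi / of_nat (N + 2) + of_int j * ?h') = pi + 2 * pi * of_int j"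
    by (simp add: distrib_left del: of_nat_add)
  then have "cis (of_nat (N + 2) * (pi / of_nat (N + 2) + of_int j * ?h')) = - 1"
    unfolding cis_eq_minus_1_iff by blast
  then show "\<exists>c. cis (of_nat (N + 2) * c) = -1 \<and> a < c \<and> c < b"
    using j \<open>a + ?h \<le> b\<close> \<open>?h' < ?h\<close> by (intro exI[of _ "pi / of_nat (N + 2) + of_int j * ?h'"]) auto
qed

text \<open>For odd \<open>N\<close> the numbers \<open>N\<close> and \<open>N + 2\<close> are
  coprime, so 1 is the only common root. The gap argument for the next root is as before, but the
  root found must also be shown to differ from 1.\<close>

lemma nontrivial_roots_of_unity_interlace:
  fixes N :: nat
  assumes "odd N"
  defines "Z \<equiv> \<lambda>N :: nat. {t. cis (of_nat N * t) = 1 \<and> cis t \<noteq> 1}"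
  shows "Z N \<inter> Z (N + 2) = {}"
    and "a \<in> Z N \<Longrightarrow> b \<in> Z N \<Longrightarrow> a < b \<Longrightarrow> \<exists>c\<in>Z (N + 2). a < c \<and> c < b"
proof -
  show "Z N \<inter> Z (N + 2) = {}"
  proof (rule ccontr)
    assume "\<not> ?thesis"
    then obtain t where t: "cis (of_nat N * t) = 1" "cis (of_nat (N + 2) * t) = 1" "cis t \<noteq> 1"
      unfolding Z_def by blast
    have "cis (of_nat (N + 2) * t) = cis (of_nat N * t) * cis t ^ 2"
      unfolding power2_eq_square cis_mult by (simp add: distrib_right add.commute)
    then have "cis t ^ 2 = 1"
      using t by simp
    obtain n where n: "N = 2 * n + 1"
      using assms(1) ..
    have "cis (of_nat N * t) = (cis t ^ 2) ^ n * cis t"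
      using Complex.DeMoivre[of t N] by (simp only: n power_mult power_add power_one_right)
    then show False
      using t \<open>cis t ^ 2 = 1\<close> by simp
  qed
next
  assume "a \<in> Z N" and "b \<in> Z N" and ab: "a < b"
  then have a: "cis (of_nat N * a) = 1" "cis a \<noteq> 1" and b: "cis (of_nat N * b) = 1"
    by (auto simp: Z_def)
  have N: "N > 0"
    using assms(1) by (cases N) auto
  let ?h = "2 * pi / of_nat N" and ?h' = "2 * pi / of_nat (N + 2)"
  obtain k l :: int where kl: "of_nat N * a = 2 * pi * of_int k" "of_nat N * b = 2 * pi * of_int l"
    using a b unfolding cis_eq_1_iff by blast
  have hN: "?h > 0"
    using N by simp
  have ak: "a = 0 + of_int k * ?h" and bl: "b = 0 + of_int l * ?h"
    using kl N by (auto simp: field_simps)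
  have "a + ?h \<le> b"
    by (rule less_multiples_gap[OF hN ak bl ab])
  obtain j :: int where j: "a < 0 + of_int j * ?h'" "0 + of_int j * ?h' \<le> a + ?h'"
    using next_multiple[of ?h' a 0] by auto
  have "?h' < ?h"
    using N by (intro divide_strict_left_mono) auto
  let ?c = "of_int j * ?h'"
  have "cis (of_nat (N + 2) * ?c) = 1"
    unfolding cis_eq_1_iff by (intro exI[of _ j]) (simp add: field_simps)
  moreover have "cis ?c \<noteq> 1"
  proof \<comment> \<open>a multiple of \<open>2\<pi>\<close> would lie on the lattice of \<open>a\<close>, hence at distance at least \<open>2\<pi> / N\<close> from it\<close>
    assume "cis ?c = 1"
    then obtain i :: int where i: "?c = 2 * pi * of_int i"
      unfolding cis_eq_1_iff by blast
    then have "?c = 0 + of_int (i * int N) * ?h"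
      using N by simp
    from less_multiples_gap[OF hN ak this] j \<open>?h' < ?h\<close> show False
      by auto
  qed
  ultimately show "\<exists>c\<in>Z (N + 2). a < c \<and> c < b"
    using j \<open>a + ?h \<le> b\<close> \<open>?h' < ?h\<close> by (intro bexI[of _ ?c]) (auto simp: Z_def)
qed

section \<open>Zeros of the three families: absolute values and interlacing\<close>

lemma poly_zeta_I: "poly (zeta_I k) z = (2 + 2 ^ k * z ^ (2 * k - 2)) / (2 ^ k + 2)"
  by (simp add: zeta_I_def poly_monom add_divide_distrib)

text \<open>Rescaling by \<open>sqrt 2\<close> moves the critical circle to the unit circle. For
  \<open>k = 1\<close> the exponent is 0 and both sides are false.\<close>

lemma zeta_I_zero_iff:
  assumes "k \<ge> 1"
  shows "poly (zeta_I k) z = 0 \<longleftrightarrow> (of_real (sqrt 2) * z) ^ (2 * k - 2) = - 1"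
proof -
  obtain m where k: "k = Suc m"
    using assms by (cases k) auto
  have "(of_real (sqrt 2) * z) ^ (2 * m) = (2 * z ^ 2) ^ m"
    by (simp only: power_mult power_mult_distrib[of _ _ 2] of_real_power[symmetric]
        real_sqrt_pow2[OF zero_le_numeral] of_real_numeral)
  also have "\<dots> = 2 ^ m * z ^ (2 * m)"
    by (simp only: power_mult power_mult_distrib)
  finally have *: "(of_real (sqrt 2) * z) ^ (2 * m) = 2 ^ m * z ^ (2 * m)" .
  have "2 + 2 ^ k * z ^ (2 * k - 2) = 2 * (1 + 2 ^ m * z ^ (2 * m))"
    by (simp add: k)
  then have "poly (zeta_I k) z = 0 \<longleftrightarrow> 2 * (1 + 2 ^ m * z ^ (2 * m)) = 0"
    unfolding poly_zeta_I by (simp only: divide_eq_0_iff denom_neq_0 simp_thms)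
  also have "\<dots> \<longleftrightarrow> 2 ^ m * z ^ (2 * m) = - 1"
    by (simp only: mult_eq_0_iff zero_neq_numeral[symmetric] add_eq_0_iff simp_thms)
  finally show ?thesis
    using * by (simp add: k)
qed

lemma geometric_zero_iff:
  fixes x :: "'a :: field_char_0"
  assumes "N > 0"
  shows "(\<Sum>i<N. x ^ i) = 0 \<longleftrightarrow> x ^ N = 1 \<and> x \<noteq> 1"
proof (cases "x = 1")
  case False
  then show ?thesis
    by (simp add: geometric_sum)
qed (use assms in simp)

lemma zeta_IV_zero_iff:
  assumes "k \<ge> 1"
  shows "poly (zeta_IV k) z = 0 \<longleftrightarrow> (- 2 * z) ^ (2 * k - 1) = 1 \<and> - 2 * z \<noteq> 1"
proof -
  have eq: "poly (zeta_IV k) z = 6 / (4 ^ k + 2) * (\<Sum>i<2 * k - 1. (- 2 * z) ^ i)"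
    unfolding zeta_IV_def by (simp only: poly_sum poly_monom power_mult_distrib sum_distrib_left mult.assoc)
  have "2 * k - 1 > 0"
    using assms by simp
  from geometric_zero_iff[OF this] show ?thesis
    by (simp only: eq mult_eq_0_iff divide_eq_0_iff denom_neq_0 zero_neq_numeral[symmetric] simp_thms)
qed

text \<open>The polynomial is a geometric sum in \<open>- 3 * z ^ 2\<close>, which has absolute
  value 1 exactly when \<open>z\<close> lies on the critical circle.\<close>

lemma zeta_III_zero_iff:
  assumes "k \<ge> 1"
  shows "poly (zeta_III k) z = 0 \<longleftrightarrow> (- 3 * z ^ 2) ^ (2 * k - 1) = 1 \<and> - 3 * z ^ 2 \<noteq> 1"
proof -
  have p: "(- 3 * z ^ 2) ^ i = (- 3) ^ i * z ^ (2 * i)" for i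
    by (simp only: power_mult_distrib power_mult)
  have eq: "poly (zeta_III k) z = 12 / (9 ^ k + 3) * (\<Sum>i<2 * k - 1. (- 3 * z ^ 2) ^ i)"
    by (simp only: zeta_III_def poly_sum poly_monom sum_distrib_left mult.assoc p)
  have "2 * k - 1 > 0"
    using assms by simp
  from geometric_zero_iff[OF this] show ?thesis
    by (simp only: eq mult_eq_0_iff divide_eq_0_iff denom_neq_0 zero_neq_numeral[symmetric] simp_thms)
qed

lemma cmod_eq_1_if_power:
  assumes "cmod (x ^ N) = 1" "N > 0"
  shows "cmod x = 1"
  using assms power_eq_imp_eq_base[of "cmod x" N 1] by (simp add: norm_power)

lemma RHA_zeta_I:
  assumes "k \<ge> 1"
  shows "RHA 2 (zeta_I k)"
  unfolding RHA_def
proof (intro allI impI)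
  fix z assume "poly (zeta_I k) z = 0"
  then have *: "(of_real (sqrt 2) * z) ^ (2 * k - 2) = - 1"
    using zeta_I_zero_iff[OF assms] by simp
  have "2 * k - 2 \<noteq> 0"
  proof
    assume "2 * k - 2 = 0"
    from *[unfolded this] show False by simp
  qed
  then have "2 * k - 2 > 0"
    by simp
  moreover have "cmod ((of_real (sqrt 2) * z) ^ (2 * k - 2)) = 1"
    unfolding * by simp
  ultimately have "cmod (of_real (sqrt 2) * z) = 1"
    by (rule cmod_eq_1_if_power[rotated])
  then have "cmod z * sqrt 2 = 1"
    by (simp add: norm_mult mult.commute)
  then show "cmod z = 1 / sqrt 2"
    by (simp add: eq_divide_eq)
qed

lemma RHA_zeta_IV:
  assumes "k \<ge> 1"
  shows "RHA 4 (zeta_IV k)"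
  unfolding RHA_def
proof (intro allI impI)
  fix z assume "poly (zeta_IV k) z = 0"
  then have *: "(- 2 * z) ^ (2 * k - 1) = 1"
    unfolding zeta_IV_zero_iff[OF assms] ..
  have "cmod ((- 2 * z) ^ (2 * k - 1)) = 1"
    unfolding * by simp
  then have "cmod (- 2 * z) = 1"
    by (rule cmod_eq_1_if_power) (use assms in simp)
  then show "cmod z = 1 / sqrt 4"
    by (simp add: norm_mult)
qed

lemma RHA_zeta_III:
  assumes "k \<ge> 1"
  shows "RHA 3 (zeta_III k)"
  unfolding RHA_def
proof (intro allI impI)
  fix z assume "poly (zeta_III k) z = 0"
  then have *: "(- 3 * z ^ 2) ^ (2 * k - 1) = 1"
    unfolding zeta_III_zero_iff[OF assms] ..
  have "cmod ((- 3 * z ^ 2) ^ (2 * k - 1)) = 1"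
    unfolding * by simp
  then have "cmod (- 3 * z ^ 2) = 1"
    by (rule cmod_eq_1_if_power) (use assms in simp)
  then have "cmod z ^ 2 = (1 / sqrt 3) ^ 2"
    by (simp add: norm_mult norm_power power_divide)
  then show "cmod z = 1 / sqrt 3"
    by (rule power2_eq_imp_eq) auto
qed

lemma interlace_zeta_I:
  assumes "k \<ge> 1"
  shows "interlace_on_circle (1 / sqrt 2) (zeta_I k) (zeta_I (Suc k))"
proof -
  have z: "zero_angles (1 / sqrt 2) (zeta_I k) = {t. cis (of_nat (2 * k - 2) * t) = - 1}" if "k \<ge> 1" for k
  proof -
    have "of_real (sqrt 2) * (complex_of_real (1 / sqrt 2) * cis t) = cis t" for t
      by (simp flip: mult.assoc of_real_mult)
    then show ?thesis
      unfolding zero_angles_def zeta_I_zero_iff[OF that] by (simp only: Complex.DeMoivre)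
  qed
  have "2 * Suc k - 2 = (2 * k - 2) + 2"
    using assms by simp
  then show ?thesis
    using roots_of_minus_1_interlace[of "2 * k - 2"]
    unfolding interlace_on_circle_def z[OF assms] z[of "Suc k", simplified] by simp
qed

lemma interlace_zeta_IV:
  assumes "k \<ge> 1"
  shows "interlace_on_circle (1 / sqrt 4) (zeta_IV k) (zeta_IV (Suc k))"
proof -
  define Z where "Z = (\<lambda>N :: nat. {t. cis (of_nat N * t) = 1 \<and> cis t \<noteq> 1})"
  \<comment> \<open>The sign in \<open>- 2 * z\<close> rotates the angle by
    \<open>pi\<close>.\<close>
  have z: "t \<in> zero_angles (1 / sqrt 4) (zeta_IV k) \<longleftrightarrow> t + pi \<in> Z (2 * k - 1)" if "k \<ge> 1" for k t
  proof -
    have "- 2 * (complex_of_real (1 / sqrt 4) * cis t) = cis (t + pi)"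
      by (simp add: real_sqrt_four flip: cis_mult)
    then show ?thesis
      unfolding zero_angles_def zeta_IV_zero_iff[OF that] mem_Collect_eq Z_def by (simp only: Complex.DeMoivre)
  qed
  have odd: "odd (2 * k - 1)" and N: "2 * Suc k - 1 = (2 * k - 1) + 2"
    using assms by auto
  have I: "Z (2 * k - 1) \<inter> Z (2 * k - 1 + 2) = {}"
    "\<And>a b. a \<in> Z (2 * k - 1) \<Longrightarrow> b \<in> Z (2 * k - 1) \<Longrightarrow> a < b \<Longrightarrow> \<exists>c\<in>Z (2 * k - 1 + 2). a < c \<and> c < b"
    unfolding Z_def by (fact nontrivial_roots_of_unity_interlace[OF odd])+
  show ?thesis
    unfolding interlace_on_circle_def
  proof (intro conjI ballI impI)
    show "zero_angles (1 / sqrt 4) (zeta_IV k) \<inter> zero_angles (1 / sqrt 4) (zeta_IV (Suc k)) = {}"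
      using I(1) z[OF assms] z[of "Suc k", unfolded N] by auto
  next
    fix a b assume "a \<in> zero_angles (1 / sqrt 4) (zeta_IV k)" "b \<in> zero_angles (1 / sqrt 4) (zeta_IV k)" "a < b"
    then obtain c where c: "c \<in> Z (2 * k - 1 + 2)" "a + pi < c" "c < b + pi"
      using I(2)[of "a + pi" "b + pi"] z[OF assms] by auto
    then show "\<exists>c\<in>zero_angles (1 / sqrt 4) (zeta_IV (Suc k)). a < c \<and> c < b"
      using z[of "Suc k" "c - pi", unfolded N] by (intro bexI[of _ "c - pi"]) auto
  qed
qed

lemma interlace_zeta_III:
  assumes "k \<ge> 1"
  shows "interlace_on_circle (1 / sqrt 3) (zeta_III k) (zeta_III (Suc k))"
proof -
  define Z where "Z = (\<lambda>N :: nat. {t. cis (of_nat N * t) = 1 \<and> cis t \<noteq> 1})"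
  \<comment> \<open>Squaring doubles the angle and the sign adds \<open>pi\<close>. The map
    \<open>2 * t + pi\<close> is an increasing bijection of the real line, so interlacing of angles
    pulls back along it.\<close>
  have z: "t \<in> zero_angles (1 / sqrt 3) (zeta_III k) \<longleftrightarrow> 2 * t + pi \<in> Z (2 * k - 1)" if "k \<ge> 1" for k t
  proof -
    have "- 3 * (complex_of_real (1 / sqrt 3) * cis t) ^ 2 = - 3 * (complex_of_real (1 / sqrt 3) ^ 2 * cis (2 * t))"
      by (simp only: power_mult_distrib Complex.DeMoivre of_nat_numeral)
    also have "complex_of_real (1 / sqrt 3) ^ 2 = 1 / 3"
      by (simp add: power_divide flip: of_real_power)
    finally have "- 3 * (complex_of_real (1 / sqrt 3) * cis t) ^ 2 = cis (2 * t + pi)"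
      by (simp flip: cis_mult)
    then show ?thesis
      unfolding zero_angles_def zeta_III_zero_iff[OF that] mem_Collect_eq Z_def by (simp only: Complex.DeMoivre)
  qed
  have odd: "odd (2 * k - 1)" and N: "2 * Suc k - 1 = (2 * k - 1) + 2"
    using assms by auto
  have I: "Z (2 * k - 1) \<inter> Z (2 * k - 1 + 2) = {}"
    "\<And>a b. a \<in> Z (2 * k - 1) \<Longrightarrow> b \<in> Z (2 * k - 1) \<Longrightarrow> a < b \<Longrightarrow> \<exists>c\<in>Z (2 * k - 1 + 2). a < c \<and> c < b"
    unfolding Z_def by (fact nontrivial_roots_of_unity_interlace[OF odd])+
  show ?thesis
    unfolding interlace_on_circle_def
  proof (intro conjI ballI impI)
    show "zero_angles (1 / sqrt 3) (zeta_III k) \<inter> zero_angles (1 / sqrt 3) (zeta_III (Suc k)) = {}"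
      using I(1) z[OF assms] z[of "Suc k", unfolded N] by auto
  next
    fix a b assume "a \<in> zero_angles (1 / sqrt 3) (zeta_III k)" "b \<in> zero_angles (1 / sqrt 3) (zeta_III k)" "a < b"
    then obtain c where c: "c \<in> Z (2 * k - 1 + 2)" "2 * a + pi < c" "c < 2 * b + pi"
      using I(2)[of "2 * a + pi" "2 * b + pi"] z[OF assms] by auto
    have "2 * ((c - pi) / 2) + pi = c" and le: "Suc k \<ge> 1"
      by (simp_all add: field_simps)
    then have "(c - pi) / 2 \<in> zero_angles (1 / sqrt 3) (zeta_III (Suc k))"
      using c(1) by (simp only: z[OF le, unfolded N])
    then show "\<exists>c\<in>zero_angles (1 / sqrt 3) (zeta_III (Suc k)). a < c \<and> c < b"
      using c(2,3) by (intro bexI[of _ "(c - pi) / 2"]) auto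
  qed
qed

section \<open>Integrality\<close>

text \<open>Fractions that need not be in lowest terms make closure under sums and products
  immediate. Conversely, the reduced denominator divides any other denominator, so it stays prime to
  \<open>p\<close>.\<close>

lemma p_integral_iff:
  assumes p: "prime p"
  shows "p_integral p z \<longleftrightarrow> (\<exists>a b :: int. \<not> int p dvd b \<and> z = of_int a / of_int b)"
proof
  have ip: "prime (int p)"
    using p by simp
  show "\<exists>a b :: int. \<not> int p dvd b \<and> z = of_int a / of_int b" if z: "p_integral p z"
  proof -
    obtain r :: rat where r: "z = of_rat r" "r = 0 \<or> padic_val p r \<ge> 0"
      using z unfolding p_integral_def by blast
    show ?thesis
    proof (cases "r = 0")
      case True
      then show ?thesis
        using r ip by (intro exI[of _ 0] exI[of _ 1]) (auto simp: not_prime_unit)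
    next
      case False
      obtain u v where uv: "quotient_of r = (u, v)"
        by (cases "quotient_of r")
      have "coprime u v" "v > 0" "r = of_int u / of_int v"
        using quotient_of_coprime[OF uv] quotient_of_denom_pos[OF uv] quotient_of_div[OF uv] by auto
      have "\<not> int p dvd v"
      proof
        assume v: "int p dvd v"
        then have "\<not> int p dvd u"
          using \<open>coprime u v\<close> ip by (meson coprime_common_divisor not_prime_unit)
        moreover have "multiplicity (int p) v > 0"
          using v ip \<open>v > 0\<close> by (subst multiplicity_gt_zero_iff) auto
        ultimately show False
          using r(2) False uv by (auto simp: padic_val_def not_dvd_imp_multiplicity_0)
      qed
      then show ?thesis
        using r(1) \<open>r = _\<close> by (auto simp: of_rat_divide)
    qed
  qed
  show "p_integral p z" if ab: "\<exists>a b :: int. \<not> int p dvd b \<and> z = of_int a / of_int b"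
  proof -
    obtain a b :: int where ab: "\<not> int p dvd b" "z = of_int a / of_int b"
      using ab by blast
    define r :: rat where "r = of_int a / of_int b"
    have "z = of_rat r"
      by (simp add: ab r_def of_rat_divide)
    obtain u v where uv: "quotient_of r = (u, v)"
      by (cases "quotient_of r")
    have uv': "coprime u v" "v > 0" "r = of_int u / of_int v"
      using quotient_of_coprime[OF uv] quotient_of_denom_pos[OF uv] quotient_of_div[OF uv] by auto
    have "b \<noteq> 0"
      using ab by auto
    then have "rat_of_int (u * b) = rat_of_int (a * v)"
      using uv'(2,3) unfolding r_def by (simp add: field_simps)
    then have "u * b = a * v"
      by (simp only: of_int_eq_iff)
    then have "v dvd u * b"
      by simp
    then have "v dvd b"
      using uv'(1) by (simp add: coprime_commute coprime_dvd_mult_right_iff)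
    then have "\<not> int p dvd v"
      using ab(1) by (meson dvd_trans)
    then have "padic_val p r \<ge> 0"
      using uv by (simp add: padic_val_def not_dvd_imp_multiplicity_0)
    then show ?thesis
      using \<open>z = of_rat r\<close> unfolding p_integral_def by blast
  qed
qed

lemma p_integral_divide:
  assumes "prime p" "\<not> int p dvd b"
  shows "p_integral p (of_int a / of_int b)"
  using assms p_integral_iff by blast

lemma p_integral_of_int: "prime p \<Longrightarrow> p_integral p (of_int a)"
  using p_integral_divide[of p 1 a] not_prime_1 by fastforce

lemma p_integral_0: "prime p \<Longrightarrow> p_integral p 0"
  using p_integral_of_int[of p 0] by simp

lemma p_integral_1: "prime p \<Longrightarrow> p_integral p 1"
  using p_integral_of_int[of p 1] by simp

lemma p_integral_of_nat: "prime p \<Longrightarrow> p_integral p (of_nat n)"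
  using p_integral_of_int[of p "int n"] by simp

lemma p_integral_add:
  assumes p: "prime p" and "p_integral p x" "p_integral p y"
  shows "p_integral p (x + y)"
proof -
  obtain a b c d :: int where "\<not> int p dvd b" "x = of_int a / of_int b" "\<not> int p dvd d" "y = of_int c / of_int d"
    using assms(2,3) unfolding p_integral_iff[OF p] by blast
  moreover from this have "b \<noteq> 0" "d \<noteq> 0" by auto
  moreover have "\<not> int p dvd b * d"
    using calculation p by (simp add: prime_dvd_mult_iff)
  ultimately show ?thesis
    unfolding p_integral_iff[OF p]
    by (intro exI[of _ "a * d + c * b"] exI[of _ "b * d"]) (simp add: add_frac_eq)
qed

lemma p_integral_mult:
  assumes p: "prime p" and "p_integral p x" "p_integral p y"
  shows "p_integral p (x * y)"
proof -
  obtain a b c d :: int where "\<not> int p dvd b" "x = of_int a / of_int b" "\<not> int p dvd d" "y = of_int c / of_int d"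
    using assms(2,3) unfolding p_integral_iff[OF p] by blast
  moreover have "\<not> int p dvd b * d"
    using calculation p by (simp add: prime_dvd_mult_iff)
  ultimately show ?thesis
    unfolding p_integral_iff[OF p]
    by (intro exI[of _ "a * c"] exI[of _ "b * d"]) simp
qed

lemma p_integral_sum:
  assumes "prime p" "\<And>x. x \<in> A \<Longrightarrow> p_integral p (f x)"
  shows "p_integral p (sum f A)"
  using assms(2)
  by (induction A rule: infinite_finite_induct) (auto intro: assms(1) p_integral_0 p_integral_add)

section \<open>Denominators modulo p\<close>

lemma fermat_int:
  fixes a :: nat
  assumes p: "prime p" "\<not> p dvd a"
  shows "int p dvd int a ^ (p - 1) - 1"
proof -
  have p0: "p > 0"
    using p(1) by (simp add: prime_gt_0_nat)
  \<comment> \<open>Induction on \<open>a\<close>: in the expansion of \<open>(a + 1) ^ p\<close>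
    all inner binomial coefficients are divisible by \<open>p\<close>.\<close>
  have "int p dvd int a ^ p - int a" for a
  proof (induction a)
    case 0
    then show ?case using p0 by (simp add: power_0_left)
  next
    case (Suc a)
    have "(int a + 1) ^ p = (\<Sum>k\<le>p. of_nat (p choose k) * int a ^ k * 1 ^ (p - k))"
      by (rule binomial_ring)
    also have "\<dots> = (\<Sum>k\<in>{..p} - {0, p}. of_nat (p choose k) * int a ^ k) + (\<Sum>k\<in>{0, p}. of_nat (p choose k) * int a ^ k)"
      by (subst sum.subset_diff[of "{0, p}"]) auto
    also have "(\<Sum>k\<in>{0, p}. of_nat (p choose k) * int a ^ k) = 1 + int a ^ p"
      using p0 by simp
    finally have "int (Suc a) ^ p - int (Suc a)
      = (\<Sum>k\<in>{..p} - {0, p}. of_nat (p choose k) * int a ^ k) + (int a ^ p - int a)"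
      by (simp add: add.commute)
    moreover have "int p dvd (\<Sum>k\<in>{..p} - {0, p}. of_nat (p choose k) * int a ^ k)"
    proof (rule dvd_sum)
      fix k assume "k \<in> {..p} - {0, p}"
      then have "p dvd p choose k"
        using p(1) p0 by (intro dvd_choose_prime) auto
      then show "int p dvd of_nat (p choose k) * int a ^ k"
        by (simp add: dvd_mult2)
    qed
    ultimately show ?case
      using Suc.IH by (metis dvd_add)
  qed
  moreover have "int a ^ p - int a = int a * (int a ^ (p - 1) - 1)"
    using p0 by (simp add: right_diff_distrib power_eq_if)
  ultimately have "int p dvd int a * (int a ^ (p - 1) - 1)"
    by metis
  then show ?thesis
    using p by (auto simp: prime_dvd_mult_iff)
qed

lemma prime_dvd_3_iff: "prime p \<Longrightarrow> int p dvd 3 \<longleftrightarrow> p = 3"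
  using primes_dvd_imp_eq[of p 3] by (auto simp: int_dvd_int_iff[of p 3, simplified])

text \<open>By Fermat the number is congruent to \<open>1 + c\<close>, which is 3 for the
  denominators of types I and IV and 4 for type III.\<close>

lemma not_dvd_power_add:
  assumes p: "prime p" "\<not> p dvd a" and c: "\<not> int p dvd 1 + c"
  shows "\<not> int p dvd int a ^ (p - 1) + c"
proof
  assume "int p dvd int a ^ (p - 1) + c"
  then have "int p dvd (int a ^ (p - 1) + c) - (int a ^ (p - 1) - 1)"
    using fermat_int[OF p] by (rule dvd_diff)
  then show False
    using c by (simp add: add.commute)
qed

lemma odd_prime_not_dvd_power_2:
  fixes p :: nat
  assumes "prime p" "odd p"
  shows "\<not> p dvd 2 ^ k"
proof
  assume "p dvd 2 ^ k"
  then have "p dvd 2"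
    using assms(1) prime_dvd_power by blast
  then have "p = 2"
    by (rule primes_dvd_imp_eq[OF assms(1) two_is_prime_nat])
  then show False
    using assms(2) by simp
qed

lemma denom_I:
  assumes "prime p" "odd p" "p \<noteq> 3"
  shows "\<not> int p dvd 2 ^ (p - 1) + 2"
  using not_dvd_power_add[of p 2 2] odd_prime_not_dvd_power_2[of p 1] prime_dvd_3_iff[of p] assms by simp

lemma denom_IV:
  assumes "prime p" "odd p" "p \<noteq> 3"
  shows "\<not> int p dvd 4 ^ (p - 1) + 2"
  using not_dvd_power_add[of p 4 2] odd_prime_not_dvd_power_2[of p 2] prime_dvd_3_iff[of p] assms by simp

text \<open>Since \<open>p - 1 = 2 * k\<close>, the power \<open>9 ^ k\<close> is
  \<open>3 ^ (p - 1)\<close>.\<close>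

lemma denom_III:
  assumes "prime p" "odd p" "p \<noteq> 3" "p - 1 = 2 * k"
  shows "\<not> int p dvd 9 ^ k + 3"
proof -
  have "\<not> int p dvd 4"
    using odd_prime_not_dvd_power_2[of p 2] assms int_dvd_int_iff[of p 4] by simp
  moreover have "\<not> p dvd 3"
    using prime_dvd_3_iff[of p] assms int_dvd_int_iff[of p 3] by simp
  ultimately have "\<not> int p dvd 3 ^ (p - 1) + 3"
    using not_dvd_power_add[of p 3 3] assms by simp
  then show ?thesis
    unfolding assms(4) power_mult by simp
qed

lemma p_integral_zeta_I:
  assumes p: "prime p" and D: "\<not> int p dvd 2 ^ k + 2"
  shows "p_integral p (coeff (zeta_I k) i)"
proof -
  have "p_integral p (2 / (2 ^ k + 2))" "p_integral p (2 ^ k / (2 ^ k + 2))"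
    using p_integral_divide[OF p D, of 2] p_integral_divide[OF p D, of "2 ^ k"] by simp_all
  then show ?thesis
    unfolding zeta_I_def coeff_add coeff_monom
    by (intro p_integral_add[OF p]) (auto intro: p_integral_0[OF p])
qed

lemma p_integral_zeta_IV:
  assumes p: "prime p" and D: "\<not> int p dvd 4 ^ k + 2"
  shows "p_integral p (coeff (zeta_IV k) i)"
proof -
  have "p_integral p (6 / (4 ^ k + 2) * (- 2) ^ j)" for j
    using p_integral_divide[OF p D, of "6 * (- 2) ^ j"] by simp
  then show ?thesis
    unfolding zeta_IV_def coeff_sum coeff_monom
    by (intro p_integral_sum[OF p]) (auto intro: p_integral_0[OF p])
qed

lemma p_integral_zeta_III:
  assumes p: "prime p" and D: "\<not> int p dvd 9 ^ k + 3"
  shows "p_integral p (coeff (zeta_III k) i)"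
proof -
  have "p_integral p (12 / (9 ^ k + 3) * (- 3) ^ j)" for j
    using p_integral_divide[OF p D, of "12 * (- 3) ^ j"] by simp
  then show ?thesis
    unfolding zeta_III_def coeff_sum coeff_monom
    by (intro p_integral_sum[OF p]) (auto intro: p_integral_0[OF p])
qed

text \<open>For \<open>p = 3\<close> the denominator 6 is divisible by \<open>p\<close>, but it
  cancels: the coefficients are those of \<open>(x^2 + y^2)^2\<close>.\<close>

lemma p_integral_wenum_I:
  assumes p: "prime p" "odd p"
  shows "p_integral p (wenum_I (p - 1) j)"
proof (cases "p = 3")
  case True
  have 4: "(4 :: nat) choose 2 = 6" "(4 :: nat) choose 3 = 4"
    by (simp_all add: eval_nat_numeral)
  have "j = 0 \<or> j = 1 \<or> j = 2 \<or> j = 3 \<or> j = 4 \<or> j > 4"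
    by linarith
  then have "wenum_I 2 j \<in> {0, 1, 2}"
    by (elim disjE) (simp_all add: wenum_I_def 4 binomial_eq_0)
  then show ?thesis
    using True p_integral_of_int[of 3 0] p_integral_of_int[of 3 1] p_integral_of_int[of 3 2] by auto
next
  case False
  define k where "k = p - 1"
  have "wenum_I k j = of_int (int ((2 * k) choose j) * (2 ^ k * 0 ^ j + 2 ^ k * 0 ^ (2 * k - j) + 1 + (-1) ^ j))
      / of_int (2 ^ k + 2)"
    by (simp add: wenum_I_def)
  then show ?thesis
    using p_integral_divide[OF p(1) denom_I[OF p False]] by (simp only: k_def)
qed

text \<open>For \<open>p = 3\<close> the denominator 18 cancels in the same way, leaving the
  coefficients of \<open>(x^2 + 3 y^2)^2\<close>.\<close>

lemma p_integral_wenum_IV: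
  assumes p: "prime p" "odd p"
  shows "p_integral p (wenum_IV (p - 1) j)"
proof (cases "p = 3")
  case True
  have 4: "(4 :: nat) choose 2 = 6" "(4 :: nat) choose 3 = 4"
    by (simp_all add: eval_nat_numeral)
  have "j = 0 \<or> j = 1 \<or> j = 2 \<or> j = 3 \<or> j = 4 \<or> j > 4"
    by linarith
  then have "wenum_IV 2 j \<in> {0, 1, 6, 9}"
    by (elim disjE) (simp_all add: wenum_IV_def 4 binomial_eq_0)
  then show ?thesis
    using True p_integral_of_int[of 3 0] p_integral_of_int[of 3 1] p_integral_of_int[of 3 6]
      p_integral_of_int[of 3 9] by auto
next
  case False
  define k where "k = p - 1"
  have "wenum_IV k j = of_int (int ((2 * k) choose j) * (4 ^ k * 0 ^ j + 3 ^ j + (-3) ^ j)) / of_int (4 ^ k + 2)"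
    by (simp add: wenum_IV_def)
  then show ?thesis
    using p_integral_divide[OF p(1) denom_IV[OF p False]] by (simp only: k_def)
qed

lemma p_integral_wenum_III:
  assumes p: "prime p" "odd p" "p \<noteq> 3" "p - 1 = 2 * k"
  shows "p_integral p (wenum_III k j)"
proof -
  have "wenum_III k j = of_int (int ((4 * k) choose j) * (9 ^ k * 0 ^ j + 2 ^ j * (if 3 dvd j then 3 else 0)))
      / of_int (9 ^ k + 3)"
    by (simp add: wenum_III_def)
  then show ?thesis
    using p_integral_divide[OF p(1) denom_III[OF p]] by (simp only:)
qed

section \<open>The theta map\<close>

text \<open>The set is a parameter so that the even and the odd theta series are treated at
  once.\<close>

definition rep_count :: "int set \<Rightarrow> nat \<Rightarrow> nat" where
  "rep_count S m = card {b \<in> S. nat (b\<^sup>2) = m}"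

definition theta_fps :: "int set \<Rightarrow> complex fps" where
  "theta_fps S = Abs_fps (\<lambda>m. of_nat (rep_count S m))"

lemma square_fiber:
  "finite {b \<in> S. nat (b\<^sup>2) = m}" "rep_count S m \<le> 2"
proof -
  have "\<exists>c. {b \<in> S. nat (b\<^sup>2) = m} \<subseteq> {c, - c}"
  proof (cases "{b \<in> S. nat (b\<^sup>2) = m} = {}")
    case False
    then obtain c where c: "nat (c\<^sup>2) = m"
      by blast
    have "b \<in> {c, - c}" if "nat (b\<^sup>2) = m" for b
    proof -
      have "b\<^sup>2 = c\<^sup>2"
        using that c by (metis nat_0_le zero_le_power2)
      then show ?thesis
        by (auto simp: power2_eq_iff)
    qed
    then show ?thesis by blast
  qed blast
  then obtain c where c: "{b \<in> S. nat (b\<^sup>2) = m} \<subseteq> {c, - c}" ..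
  then show "finite {b \<in> S. nat (b\<^sup>2) = m}"
    using finite_subset by blast
  have "card {b \<in> S. nat (b\<^sup>2) = m} \<le> card {c, - c}"
    using c by (intro card_mono) auto
  also have "\<dots> \<le> 2"
    by (simp add: card_insert_if)
  finally show "rep_count S m \<le> 2"
    by (simp add: rep_count_def)
qed

lemma summable_rep_count:
  fixes q :: complex
  assumes "norm q < 1"
  shows "summable (\<lambda>m. norm (of_nat (rep_count S m) * q ^ m))"
proof (rule summable_comparison_test')
  show "summable (\<lambda>m. 2 * norm q ^ m)"
    using assms by (intro summable_mult summable_geometric) auto
  show "norm (norm (of_nat (rep_count S m) * q ^ m)) \<le> 2 * norm q ^ m" if "m \<ge> 0" for m
    using square_fiber(2)[of S m] by (simp add: norm_mult norm_power mult_right_mono)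
qed

text \<open>The unordered sum is regrouped by the value of the square. Each fibre has at most two
  elements, so domination by a geometric series gives the absolute convergence that justifies the
  regrouping.\<close>

lemma theta_infsum:
  fixes q :: complex
  assumes q: "norm q < 1"
  shows "(\<Sum>\<^sub>\<infinity>b\<in>S. q ^ nat (b\<^sup>2)) = eval_fps (theta_fps S) q"
proof -
  let ?B = "\<lambda>m. {b \<in> S. nat (b\<^sup>2) = m}"
  let ?f = "\<lambda>(m, b). q ^ m"
  have fib: "infsum (\<lambda>b. ?f (m, b)) (?B m) = of_nat (rep_count S m) * q ^ m" for m
    using square_fiber(1)[of S m] by (simp add: rep_count_def)
  have norm_fib: "infsum (\<lambda>b. norm (?f (m, b))) (?B m) = norm (of_nat (rep_count S m) * q ^ m)" for m
    using square_fiber(1)[of S m] by (simp add: rep_count_def norm_mult)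
  have "(\<lambda>p. norm (?f p)) summable_on Sigma UNIV ?B"
    unfolding Infinite_Sum.abs_summable_on_Sigma_iff
  proof (intro conjI ballI)
    show "(\<lambda>b. norm (?f (m, b))) summable_on ?B m" for m
      using square_fiber(1)[of S m] by simp
    show "(\<lambda>m. norm (infsum (\<lambda>b. norm (?f (m, b))) (?B m))) summable_on UNIV"
      unfolding norm_fib using summable_rep_count[OF q, of S]
      by (intro norm_summable_imp_summable_on) simp_all
  qed
  then have "?f summable_on Sigma UNIV ?B"
    by (rule abs_summable_summable)
  then have "infsum ?f (Sigma UNIV ?B) = infsum (\<lambda>m. infsum (\<lambda>b. q ^ m) (?B m)) UNIV"
    by (subst infsum_Sigma'_banach[symmetric]) simp_all
  also have "\<dots> = infsum (\<lambda>m. of_nat (rep_count S m) * q ^ m) UNIV"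
    using fib by simp
  also have "\<dots> = eval_fps (theta_fps S) q"
  proof -
    have "((\<lambda>m. of_nat (rep_count S m) * q ^ m) has_sum (\<Sum>m. of_nat (rep_count S m) * q ^ m)) UNIV"
      using summable_rep_count[OF q, of S]
      by (intro norm_summable_imp_has_sum summable_sums summable_norm_cancel[OF summable_rep_count[OF q]])
    then show ?thesis
      by (simp add: infsumI eval_fps_def theta_fps_def)
  qed
  finally have "infsum ?f (Sigma UNIV ?B) = eval_fps (theta_fps S) q" .
  moreover have "infsum ?f (Sigma UNIV ?B) = (\<Sum>\<^sub>\<infinity>b\<in>S. q ^ nat (b\<^sup>2))"
    by (rule infsum_reindex_bij_witness[where i = "\<lambda>b. (nat (b\<^sup>2), b)" and j = snd]) auto
  ultimately show ?thesis
    by simp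
qed

lemma fps_conv_radius_theta: "fps_conv_radius (theta_fps S) \<ge> 1"
  unfolding fps_conv_radius_def
proof (rule conv_radius_geI_ex')
  fix r :: real assume "0 < r" "ereal r < 1"
  then have "norm (of_real r :: complex) < 1"
    by simp
  from summable_norm_cancel[OF summable_rep_count[OF this, of S]]
  show "summable (\<lambda>n. fps_nth (theta_fps S) n * of_real r ^ n)"
    by (simp add: theta_fps_def)
qed

section \<open>Expansions in powers of the nome\<close>

definition nome :: "complex \<Rightarrow> complex" where
  "nome \<tau> = exp (complex_of_real pi * \<i> * \<tau> / 2)"

lemma norm_nome: "Im \<tau> > 0 \<Longrightarrow> norm (nome \<tau>) < 1"
  by (simp add: nome_def norm_exp_eq_Re)

text \<open>Lets an identity on the upper half-plane be read as one on the punctured unit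
  disc.\<close>

lemma nome_surj:
  assumes "z \<noteq> 0" "norm z < 1"
  obtains \<tau> where "Im \<tau> > 0" "nome \<tau> = z"
proof
  let ?\<tau> = "2 * Ln z / (complex_of_real pi * \<i>)"
  have "?\<tau> = - 2 * \<i> * Ln z / complex_of_real pi"
    by (simp add: field_simps)
  then have "Im ?\<tau> = - 2 * Re (Ln z) / pi"
    by (simp add: Im_divide_of_real)
  moreover have "Re (Ln z) < 0"
    using assms by (simp add: Re_Ln)
  ultimately show "Im ?\<tau> > 0"
    by (simp add: divide_neg_pos)
  show "nome ?\<tau> = z"
    using assms(1) by (simp add: nome_def)
qed

lemma nome_power: "nome \<tau> ^ nat (b\<^sup>2) = exp (complex_of_real pi * \<i> * \<tau> * of_int b ^ 2 / 2)"
proof -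
  have "complex_of_nat (nat (b\<^sup>2)) = of_int b ^ 2"
    by (simp add: of_nat_nat)
  then show ?thesis
    by (simp add: nome_def exp_of_nat_mult[symmetric] mult.commute)
qed

text \<open>The bound on the radius is included because it makes evaluation on the disc compatible
  with sums and products of formal series.\<close>

definition has_nome_expansion :: "(complex \<Rightarrow> complex) \<Rightarrow> complex fps \<Rightarrow> bool" where
  "has_nome_expansion g F \<longleftrightarrow> fps_conv_radius F \<ge> 1 \<and> (\<forall>\<tau>. Im \<tau> > 0 \<longrightarrow> g \<tau> = eval_fps F (nome \<tau>))"

lemma has_nome_expansion_theta0: "has_nome_expansion theta0 (theta_fps {b. even b})"
  by (simp add: has_nome_expansion_def fps_conv_radius_theta theta0_def norm_nome flip: nome_power theta_infsum)

lemma has_nome_expansion_theta1: "has_nome_expansion theta1 (theta_fps {b. odd b})"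
  by (simp add: has_nome_expansion_def fps_conv_radius_theta theta1_def norm_nome flip: nome_power theta_infsum)

lemma less_conv_radius: "fps_conv_radius F \<ge> 1 \<Longrightarrow> norm (z :: complex) < 1 \<Longrightarrow> ereal (norm z) < fps_conv_radius F"
  by (meson ereal_less(3) less_le_trans)

lemma has_nome_expansion_const: "has_nome_expansion (\<lambda>_. c) (fps_const c)"
  by (simp add: has_nome_expansion_def)

lemma has_nome_expansion_add:
  assumes "has_nome_expansion g F" "has_nome_expansion h H"
  shows "has_nome_expansion (\<lambda>\<tau>. g \<tau> + h \<tau>) (F + H)"
proof -
  have "1 \<le> fps_conv_radius (F + H)"
    using assms fps_conv_radius_add[of F H] unfolding has_nome_expansion_def by (auto intro: order.trans[rotated])
  then show ?thesis
    using assms by (simp add: has_nome_expansion_def eval_fps_add less_conv_radius norm_nome)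
qed

lemma has_nome_expansion_mult:
  assumes "has_nome_expansion g F" "has_nome_expansion h H"
  shows "has_nome_expansion (\<lambda>\<tau>. g \<tau> * h \<tau>) (F * H)"
proof -
  have "1 \<le> fps_conv_radius (F * H)"
    using assms fps_conv_radius_mult[of F H] unfolding has_nome_expansion_def by (auto intro: order.trans[rotated])
  then show ?thesis
    using assms by (simp add: has_nome_expansion_def eval_fps_mult less_conv_radius norm_nome)
qed

lemma has_nome_expansion_power:
  assumes "has_nome_expansion g F"
  shows "has_nome_expansion (\<lambda>\<tau>. g \<tau> ^ n) (F ^ n)"
proof (induction n)
  case 0
  then show ?case using has_nome_expansion_const[of 1] by simp
next
  case (Suc n)
  then show ?case using has_nome_expansion_mult[OF assms] by simp
qed

lemma has_nome_expansion_sum: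
  assumes "\<And>i. i \<in> I \<Longrightarrow> has_nome_expansion (g i) (F i)"
  shows "has_nome_expansion (\<lambda>\<tau>. \<Sum>i\<in>I. g i \<tau>) (\<Sum>i\<in>I. F i)"
  using assms
proof (induction I rule: infinite_finite_induct)
  case (insert x I)
  then show ?case by (simp add: has_nome_expansion_add)
qed (use has_nome_expansion_const[of 0] in simp_all)

text \<open>Existence is the expansion itself. For uniqueness, a competing series converges on the
  punctured disc, has the same values there as \<open>F\<close>, and is therefore the same formal
  series.\<close>

lemma fourier_coeff_eq:
  assumes "has_nome_expansion g F"
  shows "fourier_coeff g = fps_nth F"
  unfolding fourier_coeff_def nome_def[symmetric]
proof (rule the_equality)
  have F: "fps_conv_radius F \<ge> 1" and g: "\<And>\<tau>. Im \<tau> > 0 \<Longrightarrow> g \<tau> = eval_fps F (nome \<tau>)"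
    using assms by (auto simp: has_nome_expansion_def)
  show "\<forall>\<tau>. Im \<tau> > 0 \<longrightarrow> (\<lambda>m. fps_nth F m * nome \<tau> ^ m) sums g \<tau>"
    using sums_eval_fps[of _ F] less_conv_radius[OF F norm_nome] g by simp
  fix c assume c: "\<forall>\<tau>. Im \<tau> > 0 \<longrightarrow> (\<lambda>m. c m * nome \<tau> ^ m) sums g \<tau>"
  let ?C = "Abs_fps c"
  have eq: "eval_fps ?C z = eval_fps F z" and sm: "summable (\<lambda>m. c m * z ^ m)" if z: "z \<noteq> 0" "norm z < 1" for z
  proof -
    obtain \<tau> where \<tau>: "Im \<tau> > 0" "nome \<tau> = z"
      using nome_surj[OF z] .
    with c have "(\<lambda>m. c m * z ^ m) sums g \<tau>"
      by blast
    then show "eval_fps ?C z = eval_fps F z" "summable (\<lambda>m. c m * z ^ m)"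
      using g[OF \<tau>(1)] \<tau>(2) by (auto simp: eval_fps_def sums_iff)
  qed
  have C: "fps_conv_radius ?C \<ge> 1"
    unfolding fps_conv_radius_def
  proof (rule conv_radius_geI_ex')
    fix r :: real assume "0 < r" "ereal r < 1"
    then show "summable (\<lambda>n. fps_nth ?C n * of_real r ^ n)"
      using sm[of "of_real r"] by simp
  qed
  \<comment> \<open>The nome never takes the value 0, so agreement at the centre has to come from
    continuity.\<close>
  have cont: "(eval_fps H \<longlongrightarrow> eval_fps H 0) (at 0)" if "fps_conv_radius H \<ge> 1" for H :: "complex fps"
    using continuous_eval_fps[of 0 H UNIV] less_conv_radius[OF that, of 0]
    by (simp add: continuous_within)
  have ev: "\<forall>\<^sub>F z in at 0. eval_fps ?C z = eval_fps F z"
    unfolding eventually_at using eq by (intro exI[of _ 1]) (auto simp: dist_norm)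
  have "(eval_fps F \<longlongrightarrow> eval_fps ?C 0) (at 0)"
    using Lim_transform_eventually[OF cont[OF C] ev] .
  then have eq0: "eval_fps ?C 0 = eval_fps F 0"
    using cont[OF F] by (intro tendsto_unique[of "at (0 :: complex)"]) auto
  have "\<forall>\<^sub>F z in nhds 0. z \<noteq> 0 \<longrightarrow> eval_fps ?C z = eval_fps F z"
    using ev by (simp add: eventually_at_filter)
  then have "\<forall>\<^sub>F z in nhds 0. eval_fps ?C z = eval_fps F z"
    by (rule eventually_mono) (metis eq0)
  then have "?C = F"
    using C F by (intro eval_fps_eqD) (auto intro: less_le_trans[of 0 "1 :: ereal"])
  then show "c = fps_nth F"
    by auto
qed

lemma p_integral_fps_mult:
  assumes "prime p" "\<And>m. p_integral p (fps_nth F m)" "\<And>m. p_integral p (fps_nth G m)"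
  shows "p_integral p (fps_nth (F * G) m)"
  unfolding fps_mult_nth using assms by (intro p_integral_sum p_integral_mult)

lemma p_integral_fps_power:
  assumes "prime p" "\<And>m. p_integral p (fps_nth F m)"
  shows "p_integral p (fps_nth (F ^ n) m)"
proof (induction n arbitrary: m)
  case 0
  then show ?case using assms(1) by (simp add: p_integral_0 p_integral_1)
next
  case (Suc n)
  then show ?case using assms by (simp add: p_integral_fps_mult)
qed

text \<open>The image under \<open>Th\<close> is a polynomial with \<open>p\<close>-integral
  coefficients in two series whose coefficients are natural numbers.\<close>

lemma p_integral_fourier_coeff_Th:
  assumes p: "prime p"
    and f: "\<And>i j. bcoeff f i j = (if i + j = n then A j else 0)" and A: "\<And>j. p_integral p (A j)"
  shows "p_integral p (fourier_coeff (Th f) m)"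
proof -
  have "f = (\<Sum>k\<le>n. [:[:A k:]:] * (varx ^ (n - k) * vary ^ k))"
    by (rule bpoly_eqI) (simp only: bcoeff_homogeneous_sum f)
  then have "Th f \<tau> = (\<Sum>k\<le>n. A k * (theta0 \<tau> ^ (n - k) * theta1 \<tau> ^ k))" for \<tau>
    by (simp add: Th_def poly_sum varx_def vary_def)
  then have Th: "Th f = (\<lambda>\<tau>. \<Sum>k\<le>n. A k * (theta0 \<tau> ^ (n - k) * theta1 \<tau> ^ k))"
    by blast
  let ?t0 = "theta_fps {b. even b}" and ?t1 = "theta_fps {b. odd b}"
  have "has_nome_expansion (Th f) (\<Sum>k\<le>n. fps_const (A k) * (?t0 ^ (n - k) * ?t1 ^ k))"
    unfolding Th by (intro has_nome_expansion_sum has_nome_expansion_mult has_nome_expansion_const has_nome_expansion_power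
        has_nome_expansion_theta0 has_nome_expansion_theta1)
  then have "fourier_coeff (Th f) m = fps_nth (\<Sum>k\<le>n. fps_const (A k) * (?t0 ^ (n - k) * ?t1 ^ k)) m"
    by (simp only: fourier_coeff_eq)
  also have "\<dots> = (\<Sum>k\<le>n. A k * fps_nth (?t0 ^ (n - k) * ?t1 ^ k) m)"
    by (simp add: fps_sum_nth)
  finally show ?thesis
    using p A by (simp only:) (intro p_integral_sum p_integral_mult p_integral_fps_mult p_integral_fps_power;
        simp add: theta_fps_def p_integral_of_nat)
qed

section \<open>The normalized Eisenstein polynomials\<close>

text \<open>An infinite group would have \<open>card\<close> equal to 0, and
  \<open>1 / 0 = 0\<close>.\<close>

lemma finite_grp_if_eisenstein: "eisenstein X l \<noteq> 0 \<Longrightarrow> finite (grp X)"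
  by (rule ccontr) (simp add: eisenstein_def)

lemma eisenstein_eq_0I:
  assumes "\<And>i j. i + j = l \<Longrightarrow>
    (\<Sum>\<sigma>\<in>grp X. (\<sigma> $ 1 $ 1) ^ i * (\<sigma> $ 1 $ 2) ^ j) / of_nat (card (grp X)) = 0"
  shows "eisenstein X l = 0"
  by (rule bpoly_eqI) (simp add: bcoeff_eisenstein assms)

lemma bcoeff_normalizedI:
  fixes M :: "nat \<Rightarrow> nat \<Rightarrow> complex"
  assumes M: "\<And>i j. i + j = l \<Longrightarrow>
      (\<Sum>\<sigma>\<in>grp X. (\<sigma> $ 1 $ 1) ^ i * (\<sigma> $ 1 $ 2) ^ j) / of_nat (card (grp X)) = M i j"
    and A: "\<And>i j. i + j = l \<Longrightarrow> of_nat (l choose j) * M i j = A j * M l 0" and "M l 0 \<noteq> 0"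
  shows "bcoeff (eisenstein_normalized X l) i j = (if i + j = l then A j else 0)"
proof -
  have e: "bcoeff (eisenstein X l) i j = (if i + j = l then of_nat (l choose j) * M i j else 0)" for i j
    by (simp add: bcoeff_eisenstein M)
  have "bcoeff (eisenstein X l) l 0 = M l 0"
    by (simp add: e)
  then show ?thesis
    using A[of i j] \<open>M l 0 \<noteq> 0\<close> by (auto simp: eisenstein_normalized_def bcoeff_smult e)
qed

lemma normalized_TypeI:
  assumes fin: "finite (grp TypeI)" and k: "k \<ge> 1"
  shows "bcoeff (eisenstein_normalized TypeI (2 * k)) i j = (if i + j = 2 * k then wenum_I k j else 0)"
proof (rule bcoeff_normalizedI)
  let ?M = "\<lambda>i j. (0 ^ j + 0 ^ i + (1 + (-1) ^ j) / 2 ^ k) / 4 :: complex"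
  have s: "complex_of_real (1 / sqrt 2) ^ (2 * k) = 1 / 2 ^ k"
    by (simp add: power_mult power_divide flip: of_real_power)
  show "(\<Sum>\<sigma>\<in>grp TypeI. (\<sigma> $ 1 $ 1) ^ i * (\<sigma> $ 1 $ 2) ^ j) / of_nat (card (grp TypeI)) = ?M i j"
    if "i + j = 2 * k" for i j
    using that moment_TypeI[OF fin, of i j] s by simp
  \<comment> \<open>\<open>k \<ge> 1\<close> removes the term \<open>0 ^ (2 * k)\<close>.\<close>
  have M0: "?M (2 * k) 0 = (2 ^ k + 2) / (2 ^ k * 4)"
    using k by (simp add: power_0_left field_simps)
  show "?M (2 * k) 0 \<noteq> 0"
    unfolding M0 by simp
  show "of_nat (2 * k choose j) * ?M i j = wenum_I k j * ?M (2 * k) 0" if ij: "i + j = 2 * k" for i j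
  proof -
    have i: "2 * k - j = i"
      using ij by simp
    \<comment> \<open>\<open>z\<close> stands for \<open>1 + (-1) ^ j\<close>, which
      \<open>wenum_I\<close> has as two separate summands; hence the form
      \<open>1 + (z - 1)\<close>.\<close>
    have "N * ((x + y + z / P) / 4) = N * (P * x + P * y + 1 + (z - 1)) / D * (D / (P * 4))"
      if "P \<noteq> 0" "D \<noteq> 0" for N x y z P D :: complex
      using that by (simp add: field_simps)
    from this[of "2 ^ k" "2 ^ k + 2" "of_nat (2 * k choose j)" "0 ^ j" "0 ^ i" "1 + (-1) ^ j"]
    show ?thesis
      unfolding M0 wenum_I_def i by simp
  qed
qed

lemma normalized_TypeIV:
  assumes fin: "finite (grp TypeIV)"
  shows "bcoeff (eisenstein_normalized TypeIV (2 * k)) i j = (if i + j = 2 * k then wenum_IV k j else 0)"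
proof (rule bcoeff_normalizedI)
  let ?M = "\<lambda>i j. (0 ^ j + (3 ^ j + (-3) ^ j) / 4 ^ k) / 3 :: complex"
  have s: "(1 / 2 :: complex) ^ (2 * k) = 1 / 4 ^ k"
    by (simp add: power_mult power_divide)
  show "(\<Sum>\<sigma>\<in>grp TypeIV. (\<sigma> $ 1 $ 1) ^ i * (\<sigma> $ 1 $ 2) ^ j) / of_nat (card (grp TypeIV)) = ?M i j"
    if "i + j = 2 * k" for i j
    unfolding moment_TypeIV[OF fin, of i j] that s by simp
  have M0: "?M (2 * k) 0 = (4 ^ k + 2) / (4 ^ k * 3)"
    by (simp add: field_simps)
  show "?M (2 * k) 0 \<noteq> 0"
    unfolding M0 by simp
  show "of_nat (2 * k choose j) * ?M i j = wenum_IV k j * ?M (2 * k) 0" if ij: "i + j = 2 * k" for i j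
  proof -
    have "N * ((x + (y + z) / P) / 3) = N * (P * x + y + z) / D * (D / (P * 3))"
      if "P \<noteq> 0" "D \<noteq> 0" for N x y z P D :: complex
      using that by (simp add: field_simps)
    from this[of "4 ^ k" "4 ^ k + 2"]
    show ?thesis
      unfolding M0 wenum_IV_def by simp
  qed
qed

lemma normalized_TypeIII:
  assumes fin: "finite (grp TypeIII)"
  shows "bcoeff (eisenstein_normalized TypeIII (4 * k)) i j = (if i + j = 4 * k then wenum_III k j else 0)"
proof (rule bcoeff_normalizedI)
  let ?M = "\<lambda>i j. (0 ^ j + 2 ^ j * (if 3 dvd j then 3 else 0) / 9 ^ k) / 4 :: complex"
  have "complex_of_real (1 / sqrt 3) ^ (4 * k) = (complex_of_real (1 / sqrt 3) ^ 2) ^ (2 * k)"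
    by (simp add: power_mult[symmetric])
  also have "complex_of_real (1 / sqrt 3) ^ 2 = 1 / 3"
    by (simp add: power_divide flip: of_real_power)
  also have "(1 / 3 :: complex) ^ (2 * k) = 1 / 9 ^ k"
    by (simp add: power_mult power_divide)
  finally have s: "complex_of_real (1 / sqrt 3) ^ (4 * k) = 1 / 9 ^ k" .
  show "(\<Sum>\<sigma>\<in>grp TypeIII. (\<sigma> $ 1 $ 1) ^ i * (\<sigma> $ 1 $ 2) ^ j) / of_nat (card (grp TypeIII)) = ?M i j"
    if "i + j = 4 * k" for i j
    unfolding moment_TypeIII[OF fin, of i j] that s by simp
  have M0: "?M (4 * k) 0 = (9 ^ k + 3) / (9 ^ k * 4)"
    by (simp add: field_simps)
  show "?M (4 * k) 0 \<noteq> 0"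
    unfolding M0 by simp
  show "of_nat (4 * k choose j) * ?M i j = wenum_III k j * ?M (4 * k) 0" if ij: "i + j = 4 * k" for i j
  proof -
    have "N * ((x + y / P) / 4) = N * (P * x + y) / D * (D / (P * 4))"
      if "P \<noteq> 0" "D \<noteq> 0" for N x y P D :: complex
      using that by (simp add: field_simps)
    from this[of "9 ^ k" "9 ^ k + 3"]
    show ?thesis
      unfolding M0 wenum_III_def by simp
  qed
qed

lemma eisenstein_nonzero_imp_dvd:
  assumes "eisenstein X l \<noteq> 0"
  shows "wpar X dvd l"
proof (rule ccontr)
  assume not: "\<not> wpar X dvd l"
  have fin: "finite (grp X)"
    by (rule finite_grp_if_eisenstein[OF assms])
  have "eisenstein X l = 0"
  proof (rule eisenstein_eq_0I)
    fix i j assume "i + j = l"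
    then show "(\<Sum>\<sigma>\<in>grp X. (\<sigma> $ 1 $ 1) ^ i * (\<sigma> $ 1 $ 2) ^ j) / of_nat (card (grp X)) = 0"
      using not fin moment_TypeI[of i j] moment_TypeIII[of i j] moment_TypeIV[of i j]
      by (cases X) (simp_all only: wpar.simps if_False)
  qed
  with assms show False ..
qed

section \<open>Assembling the three types\<close>

definition zeta_of :: "gtype \<Rightarrow> nat \<Rightarrow> complex poly" where
  "zeta_of X k = (case X of TypeI \<Rightarrow> zeta_I k | TypeIII \<Rightarrow> zeta_III k | TypeIV \<Rightarrow> zeta_IV k)"

lemma zeta_poly_eisenstein:
  assumes "finite (grp X)" "k \<ge> 1"
  shows "zeta_poly (qpar X) (wpar X * k) (eisenstein_normalized X (wpar X * k)) = zeta_of X k"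
proof (cases X)
  case TypeI
  then show ?thesis
    using assms zeta_poly_TypeI[OF normalized_TypeI] by (simp add: zeta_of_def)
next
  case TypeIII
  then show ?thesis
    using assms zeta_poly_TypeIII[OF normalized_TypeIII] by (simp add: zeta_of_def)
next
  case TypeIV
  then show ?thesis
    using assms zeta_poly_TypeIV[OF normalized_TypeIV] by (simp add: zeta_of_def)
qed

lemma eisenstein_nonzeroE:
  assumes "eisenstein X l \<noteq> 0" "l \<ge> 1"
  obtains k where "l = wpar X * k" "k \<ge> 1" "finite (grp X)"
proof -
  obtain k where "l = wpar X * k"
    using eisenstein_nonzero_imp_dvd[OF assms(1)] ..
  moreover from this have "k \<ge> 1"
    using assms(2) by (cases k) auto
  ultimately show ?thesis
    using that finite_grp_if_eisenstein[OF assms(1)] by blast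
qed

text \<open>Stated through a coefficient sequence, so that it serves both for the polynomial and for
  its theta image.\<close>

lemma normalized_coefficients_integral:
  assumes p: "prime p" "odd p" "X = TypeIII \<longrightarrow> p \<noteq> 3" and "finite (grp X)"
  obtains A where "\<And>i j. bcoeff (eisenstein_normalized X (2 * (p - 1))) i j = (if i + j = 2 * (p - 1) then A j else 0)"
    "\<And>j. p_integral p (A j)"
proof (cases X)
  case TypeI
  have "p - 1 \<ge> 1"
    using prime_ge_2_nat[OF p(1)] by simp
  with TypeI show ?thesis
    using that[of "wenum_I (p - 1)"] normalized_TypeI assms(4) p_integral_wenum_I[OF p(1,2)] by simp
next
  case TypeIV
  then show ?thesis
    using that[of "wenum_IV (p - 1)"] normalized_TypeIV assms(4) p_integral_wenum_IV[OF p(1,2)] by simp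
next
  case TypeIII
  obtain k where k: "p - 1 = 2 * k"
    using p(2) by (auto elim!: oddE)
  then have "2 * (p - 1) = 4 * k" by simp
  with TypeIII show ?thesis
    using that[of "wenum_III k"] normalized_TypeIII assms(4) p_integral_wenum_III[OF p(1,2) _ k] p(3) by simp
qed

text \<open>The prime 3 is excluded in every type: in degree 4 the constant terms in types I and IV
  are 1/3.\<close>

lemma zeta_coefficients_integral:
  assumes p: "prime p" "odd p" "p \<noteq> 3" and "finite (grp X)"
  shows "p_integral p (coeff (zeta_poly (qpar X) (2 * (p - 1)) (eisenstein_normalized X (2 * (p - 1)))) i)"
proof -
  have p1: "p - 1 \<ge> 1"
    using prime_ge_2_nat[OF p(1)] by simp
  obtain k where k: "p - 1 = 2 * k"
    using p(2) by (auto elim!: oddE)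
  with p1 have "k \<ge> 1" by simp
  have k4: "4 * k = 2 * (p - 1)"
    using k by simp
  show ?thesis
  proof (cases X)
    case TypeI
    then show ?thesis
      using zeta_poly_eisenstein[OF assms(4) p1] p_integral_zeta_I[OF p(1) denom_I[OF p]]
      by (simp add: zeta_of_def)
  next
    case TypeIV
    then show ?thesis
      using zeta_poly_eisenstein[OF assms(4) p1] p_integral_zeta_IV[OF p(1) denom_IV[OF p]]
      by (simp add: zeta_of_def)
  next
    case TypeIII
    then show ?thesis
      using zeta_poly_eisenstein[OF assms(4) \<open>k \<ge> 1\<close>] p_integral_zeta_III[OF p(1) denom_III[OF p k]]
      by (simp add: zeta_of_def k4)
  qed
qed

lemma RHA_zeta_of: "k \<ge> 1 \<Longrightarrow> RHA (qpar X) (zeta_of X k)"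
  by (cases X) (simp_all add: zeta_of_def RHA_zeta_I RHA_zeta_III RHA_zeta_IV)

lemma interlace_zeta_of:
  "k \<ge> 1 \<Longrightarrow> interlace_on_circle (1 / sqrt (qpar X)) (zeta_of X k) (zeta_of X (Suc k))"
  using interlace_zeta_I interlace_zeta_III interlace_zeta_IV
  by (cases X) (simp_all only: zeta_of_def qpar.simps gtype.case)

theorem theorem1p5:
  fixes X :: gtype
  shows
    "(\<forall>l\<ge>1. eisenstein X l \<noteq> 0 \<longrightarrow>
        RHA (qpar X) (zeta_poly (qpar X) l (eisenstein_normalized X l)))
   \<and> (\<forall>l\<ge>1. eisenstein X l \<noteq> 0 \<longrightarrow>
        interlace_on_circle (1 / sqrt (qpar X))
          (zeta_poly (qpar X) l (eisenstein_normalized X l))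
          (zeta_poly (qpar X) (l + wpar X) (eisenstein_normalized X (l + wpar X))))
   \<and> (\<forall>p::nat. prime p \<and> odd p \<and> p \<noteq> 3 \<and> eisenstein X (2 * (p - 1)) \<noteq> 0 \<longrightarrow>
        (\<forall>k. p_integral p
           (coeff (zeta_poly (qpar X) (2 * (p - 1)) (eisenstein_normalized X (2 * (p - 1)))) k)))
   \<and> (\<forall>p::nat. prime p \<and> odd p \<and> (X = TypeIII \<longrightarrow> p \<noteq> 3) \<and> eisenstein X (2 * (p - 1)) \<noteq> 0 \<longrightarrow>
        (\<forall>i j. p_integral p (bcoeff (eisenstein_normalized X (2 * (p - 1))) i j)))
   \<and> (\<forall>p::nat. prime p \<and> odd p \<and> (X = TypeIII \<longrightarrow> p \<noteq> 3) \<and> eisenstein X (2 * (p - 1)) \<noteq> 0 \<longrightarrow>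
        (\<forall>m. p_integral p (fourier_coeff (Th (eisenstein_normalized X (2 * (p - 1)))) m)))"
proof (intro conjI allI impI; (elim conjE)?)
  fix l assume l: "1 \<le> l" "eisenstein X l \<noteq> 0"
  obtain k where k: "l = wpar X * k" "k \<ge> 1" "finite (grp X)"
    using eisenstein_nonzeroE[OF l(2,1)] .
  then show "RHA (qpar X) (zeta_poly (qpar X) l (eisenstein_normalized X l))"
    by (simp add: zeta_poly_eisenstein RHA_zeta_of)
next
  fix l assume l: "1 \<le> l" "eisenstein X l \<noteq> 0"
  obtain k where k: "l = wpar X * k" "k \<ge> 1" "finite (grp X)"
    using eisenstein_nonzeroE[OF l(2,1)] .
  \<comment> \<open>The larger degree is the next multiple of \<open>wpar X\<close>, so its zeta
    polynomial is given by the same formula at \<open>Suc k\<close>.\<close>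
  have l': "wpar X * k + wpar X = wpar X * Suc k"
    by simp
  show "interlace_on_circle (1 / sqrt (qpar X))
      (zeta_poly (qpar X) l (eisenstein_normalized X l))
      (zeta_poly (qpar X) (l + wpar X) (eisenstein_normalized X (l + wpar X)))"
    unfolding k(1) l' zeta_poly_eisenstein[OF k(3,2)] zeta_poly_eisenstein[OF k(3) le_SucI[OF k(2)]]
    by (rule interlace_zeta_of[OF k(2)])
next
  fix p i :: nat
  assume "prime p" "odd p" "p \<noteq> 3" "eisenstein X (2 * (p - 1)) \<noteq> 0"
  then show "p_integral p
      (coeff (zeta_poly (qpar X) (2 * (p - 1)) (eisenstein_normalized X (2 * (p - 1)))) i)"
    by (intro zeta_coefficients_integral finite_grp_if_eisenstein)
next
  fix p i j :: nat
  assume p: "prime p" "odd p" "X = TypeIII \<longrightarrow> p \<noteq> 3" and e: "eisenstein X (2 * (p - 1)) \<noteq> 0"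
  obtain A where "\<And>i j. bcoeff (eisenstein_normalized X (2 * (p - 1))) i j = (if i + j = 2 * (p - 1) then A j else 0)"
    "\<And>j. p_integral p (A j)"
    by (rule normalized_coefficients_integral[OF p finite_grp_if_eisenstein[OF e]]) (rule that)
  then show "p_integral p (bcoeff (eisenstein_normalized X (2 * (p - 1))) i j)"
    using p_integral_0[OF p(1)] by simp
next
  fix p m :: nat
  assume p: "prime p" "odd p" "X = TypeIII \<longrightarrow> p \<noteq> 3" and e: "eisenstein X (2 * (p - 1)) \<noteq> 0"
  obtain A where A: "\<And>i j. bcoeff (eisenstein_normalized X (2 * (p - 1))) i j = (if i + j = 2 * (p - 1) then A j else 0)"
    "\<And>j. p_integral p (A j)"
    by (rule normalized_coefficients_integral[OF p finite_grp_if_eisenstein[OF e]]) (rule that)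
  show "p_integral p (fourier_coeff (Th (eisenstein_normalized X (2 * (p - 1)))) m)"
    by (rule p_integral_fourier_coeff_Th[OF p(1) A])
qed

end
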